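(* There is a deterministic algorithm and a function in $O(n\log n)$ bounding its running time such that the following holds. Given an $n$-vertex graph $G$ in the form of an RDV representation $(T,t,b)$ of $G$ whose host tree $T$ has $O(n)$ nodes, the algorithm outputs a minimum dominating set of $G$ in $O(n\log n)$ time (in particular, the running time bound does not depend on the number of edges of $G$).
   Context: All graphs are finite and simple. For a vertex $z$ of a graph $G$, $N[z]$ denotes the closed neighbourhood, i.e. $z$ together with all its neighbours. A set $S$ of vertices is dominating if every vertex of $G$ is in $S$ or adjacent to a vertex of $S$; a minimum dominating set is one of smallest cardinality. An RDV representation $(T,t,b)$ of a graph $G$ consists of a rooted tree $T$ (the host tree; its vertices are called nodes) and, for every vertex $z$ of $G$, a top node $t(z)$ and a bottom node $b(z)$ of $T$ such that $b(z)$ is a descendant of $t(z)$ (possibly $b(z)=t(z)$). Let $T(z)$ be the path in $T$ between $t(z)$ and $b(z)$ (a downward path). It is required that for any two distinct vertices $z,w$ of $G$, $(z,w)$ is an edge of $G$ if and only if $T(z)$ and $T(w)$ share at least one node of $T$. An RDV graph is a graph that has an RDV representation. The input is the rooted tree $T$ together with the node pair $(t(z),b(z))$ for each vertex $z$; the edges of $G$ are not listed explicitly. $|T|$ denotes the number of nodes of $T$. Running time is measured in the standard unit-cost word-RAM model with words of $\Theta(\log n)$ bits. *)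

theory Defs
  imports
    Complex_Main
    "HOL-Library.Landau_Symbols"
    "Graph_Theory.Pair_Digraph"
begin

section \<open>Dominating sets\<close>

text \<open>Finite simple graphs are the symmetric loop-free digraphs of locale \<open>pair_graph\<close>.\<close>

definition dominating_set :: "'v pair_pre_digraph \<Rightarrow> 'v set \<Rightarrow> bool" where
  "dominating_set G S \<longleftrightarrow>
     S \<subseteq> pverts G \<and> (\<forall>v \<in> pverts G. v \<in> S \<or> (\<exists>u \<in> S. (v, u) \<in> parcs G))"

definition minimum_dominating_set :: "'v pair_pre_digraph \<Rightarrow> 'v set \<Rightarrow> bool" where
  "minimum_dominating_set G S \<longleftrightarrow>
     dominating_set G S \<and> (\<forall>S'. dominating_set G S' \<longrightarrow> card S \<le> card S')"


section \<open>Rooted trees and RDV representations\<close>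

text \<open>
  A rooted tree is given by its parent map, with the convention that the root is its own parent.
  Since every node reaches the root by iterating the map, the map has no other cycle.
\<close>

record 'n rooted_tree =
  nodes :: "'n set"
  root :: 'n
  parent :: "'n \<Rightarrow> 'n"

definition is_rooted_tree :: "'n rooted_tree \<Rightarrow> bool" where
  "is_rooted_tree T \<longleftrightarrow>
     finite (nodes T) \<and> root T \<in> nodes T \<and> parent T (root T) = root T \<and>
     (\<forall>x \<in> nodes T. parent T x \<in> nodes T \<and> (\<exists>k. (parent T ^^ k) x = root T))"

definition descendant :: "'n rooted_tree \<Rightarrow> 'n \<Rightarrow> 'n \<Rightarrow> bool" where
  "descendant T x y \<longleftrightarrow> (\<exists>k. (parent T ^^ k) x = y)"

text \<open>
  The node set of the path between \<open>x\<close> and its descendant \<open>y\<close>: the nodes met when climbing from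
  \<open>y\<close> until \<open>x\<close> is reached for the first time.
\<close>

definition downward_path :: "'n rooted_tree \<Rightarrow> 'n \<Rightarrow> 'n \<Rightarrow> 'n set" where
  "downward_path T x y = {(parent T ^^ i) y | i. i \<le> (LEAST k. (parent T ^^ k) y = x)}"

definition rdv_representation ::
    "'v pair_pre_digraph \<Rightarrow> 'n rooted_tree \<Rightarrow> ('v \<Rightarrow> 'n) \<Rightarrow> ('v \<Rightarrow> 'n) \<Rightarrow> bool" where
  "rdv_representation G T t b \<longleftrightarrow>
     is_rooted_tree T \<and>
     (\<forall>z \<in> pverts G. t z \<in> nodes T \<and> b z \<in> nodes T \<and> descendant T (b z) (t z)) \<and>
     (\<forall>z \<in> pverts G. \<forall>w \<in> pverts G. z \<noteq> w \<longrightarrow>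
        ((z, w) \<in> parcs G \<longleftrightarrow>
         downward_path T (t z) (b z) \<inter> downward_path T (t w) (b w) \<noteq> {}))"


section \<open>The unit-cost word RAM\<close>

text \<open>
  Words of length \<open>w\<close> are the naturals below \<open>2 ^ w\<close>. They serve both as data and as addresses, so
  at most \<open>2 ^ w\<close> memory cells can be addressed. A program is a finite list of instructions and
  therefore names only finitely many registers; it is fixed independently of the input and of \<open>w\<close>.
\<close>

datatype binop = Add | Sub | Mul | Div | Mod | And | Or | Xor | Shl | Shr | Less | Equal

fun eval_binop :: "nat \<Rightarrow> binop \<Rightarrow> nat \<Rightarrow> nat \<Rightarrow> nat" where
  "eval_binop w Add x y = (x + y) mod 2 ^ w"
| "eval_binop w Sub x y = (x + 2 ^ w - y) mod 2 ^ w"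
| "eval_binop w Mul x y = (x * y) mod 2 ^ w"
| "eval_binop w Div x y = x div y"
| "eval_binop w Mod x y = x mod y"
| "eval_binop w And x y = and x y"
| "eval_binop w Or x y = or x y"
| "eval_binop w Xor x y = xor x y"
| "eval_binop w Shl x y = push_bit y x mod 2 ^ w"
| "eval_binop w Shr x y = drop_bit y x"
| "eval_binop w Less x y = of_bool (x < y)"
| "eval_binop w Equal x y = of_bool (x = y)"

type_synonym reg = nat

datatype instr =
    Const reg nat
  | Copy reg reg
  | Arith binop reg reg reg
  | Load reg reg
  | Store reg reg
  | Jump nat
  | JumpIf reg nat

type_synonym program = "instr list"

record config =
  pc :: nat
  regs :: "reg \<Rightarrow> nat"
  mem :: "nat \<Rightarrow> nat"

fun exec_instr :: "nat \<Rightarrow> instr \<Rightarrow> config \<Rightarrow> config" where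
  "exec_instr w (Const d c) s = s\<lparr>pc := Suc (pc s), regs := (regs s)(d := c mod 2 ^ w)\<rparr>"
| "exec_instr w (Copy d a) s = s\<lparr>pc := Suc (pc s), regs := (regs s)(d := regs s a)\<rparr>"
| "exec_instr w (Arith f d a a') s =
     s\<lparr>pc := Suc (pc s), regs := (regs s)(d := eval_binop w f (regs s a) (regs s a'))\<rparr>"
| "exec_instr w (Load d a) s = s\<lparr>pc := Suc (pc s), regs := (regs s)(d := mem s (regs s a))\<rparr>"
| "exec_instr w (Store a d) s =
     s\<lparr>pc := Suc (pc s), mem := (mem s)(regs s a := regs s d)\<rparr>"
| "exec_instr w (Jump l) s = s\<lparr>pc := l\<rparr>"
| "exec_instr w (JumpIf a l) s = s\<lparr>pc := (if regs s a \<noteq> 0 then l else Suc (pc s))\<rparr>"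

text \<open>The machine halts when the program counter leaves the program.\<close>

definition halted :: "program \<Rightarrow> config \<Rightarrow> bool" where
  "halted P s \<longleftrightarrow> length P \<le> pc s"

definition step :: "nat \<Rightarrow> program \<Rightarrow> config \<Rightarrow> config" where
  "step w P s = (if halted P s then s else exec_instr w (P ! pc s) s)"

text \<open>
  The input occupies the memory cells from address 0 on. Input that does not fit into the
  addressable cells and into words of length \<open>w\<close> is truncated, so that a program cannot profit
  from a word length that is too small for its input.
\<close>

definition initial_config :: "nat \<Rightarrow> nat list \<Rightarrow> config" where
  "initial_config w xs =
     \<lparr>pc = 0, regs = (\<lambda>_. 0),
      mem = (\<lambda>a. if a < length xs \<and> a < 2 ^ w then xs ! a mod 2 ^ w else 0)\<rparr>"

text \<open>The output is a list of words: its length in cell 0, followed by its entries.\<close>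

definition output_of :: "config \<Rightarrow> nat list" where
  "output_of s = map (mem s) [1..<Suc (mem s 0)]"

definition outputs_within :: "nat \<Rightarrow> program \<Rightarrow> nat list \<Rightarrow> nat \<Rightarrow> nat list \<Rightarrow> bool" where
  "outputs_within w P xs k ys \<longleftrightarrow>
     (\<exists>j \<le> k. let s = (step w P ^^ j) (initial_config w xs) in halted P s \<and> output_of s = ys)"


section \<open>Input encoding\<close>

text \<open>
  The vertices are \<open>0, \<dots>, n - 1\<close> and the nodes are \<open>0, \<dots>, m - 1\<close>, in arbitrary order. The root is
  the node that is its own parent.
\<close>

definition encode_rdv ::
    "nat \<Rightarrow> nat \<Rightarrow> nat rooted_tree \<Rightarrow> (nat \<Rightarrow> nat) \<Rightarrow> (nat \<Rightarrow> nat) \<Rightarrow> nat list" where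
  "encode_rdv n m T t b =
     [n, m] @ map (parent T) [0..<m] @ map t [0..<n] @ map b [0..<n]"

end

theory Submission
  imports Defs
begin

text \<open>
  Process the nodes of the host tree bottom-up. When a node \<open>x\<close> is the top of a vertex not dominated
  so far, select, among the vertices whose path contains \<open>x\<close>, one whose top is as high as possible.
  A path that meets the path of this vertex and one that is treated later meets the latter in a node
  that the selected path contains as well. Hence no vertex dominates two of the vertices that
  triggered a selection, which bounds the size of every dominating set from below.

  Tops of paths through a common node are comparable, so their heights may be replaced by their
  positions in any bottom-up numbering; repeated removal of leaves provides one in linear time. The
  highest top and the state of domination are then passed from child to parent by taking maxima.
  Every loop body is free of branches: conditional updates are done by modular arithmetic.
\<close>

section \<open>Trees with a bottom-up numbering\<close>

text \<open>One number per node is enough to record domination. If a selected path runs through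
  \<open>x\<close>, it dominates every vertex whose path contains \<open>x\<close>, so only the
  highest reach of such paths matters; when that reach is \<open>x\<close> itself, nothing has to be
  reported upwards. If no selected path runs through \<open>x\<close>, only the lowest top among the
  open vertices through \<open>x\<close> matters: the selection made at that top takes a path
  through it, which also dominates the open vertices that continue higher. So ranking covered above
  open, and low open tops above high ones, loses nothing under maxima. The table of highest tops
  never deletes a path that has ended. A path whose top is strictly below \<open>x\<close> has a
  smaller position there than any path containing \<open>x\<close>, so it cannot win where a
  selection is made. The running time is linear. The demand on the word length comes from packing a
  position and a vertex into one key below \<open>Suc m * n\<close>: words must hold quadratic
  values, while addresses stay linear.\<close>

definition below :: "('n \<Rightarrow> 'n) \<Rightarrow> 'n \<Rightarrow> 'n \<Rightarrow> bool" where
  "below p x y \<longleftrightarrow> (\<exists>k. (p ^^ k) x = y)"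

lemma below_refl [simp]: "below p x x"
  unfolding below_def by (rule exI [of _ 0]) simp

lemma below_trans: "below p x y \<Longrightarrow> below p y z \<Longrightarrow> below p x z"
  unfolding below_def by (metis comp_apply funpow_add)

lemma below_parent: "below p x (p x)"
  unfolding below_def by (rule exI [of _ 1]) simp

lemma below_comparable:
  assumes "below p x y" "below p x z"
  shows "below p y z \<or> below p z y"
proof -
  obtain i j where i: "(p ^^ i) x = y" and j: "(p ^^ j) x = z"
    using assms unfolding below_def by blast
  have "(p ^^ (j - i)) y = z" if "i \<le> j"
    using that i j by (metis comp_apply funpow_add le_add_diff_inverse2)
  moreover have "(p ^^ (i - j)) z = y" if "j \<le> i"
    using that i j by (metis comp_apply funpow_add le_add_diff_inverse2)
  ultimately show ?thesis
    unfolding below_def by (meson nat_le_linear)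
qed

lemma below_step:
  assumes "below p x y" "x \<noteq> y"
  shows "below p (p x) y"
proof -
  obtain k where k: "(p ^^ k) x = y"
    using assms unfolding below_def by blast
  with assms(2) obtain l where "k = Suc l"
    by (cases k) auto
  with k show ?thesis
    unfolding below_def by (metis comp_apply funpow_Suc_right)
qed

lemma below_last_step:
  assumes "below p x y" "x \<noteq> y"
  obtains c where "below p x c" "p c = y" "c \<noteq> y"
proof -
  define k where "k = (LEAST k. (p ^^ k) x = y)"
  have k: "(p ^^ k) x = y"
    unfolding k_def using assms(1) unfolding below_def by (rule LeastI_ex)
  with assms(2) obtain l where l: "k = Suc l"
    by (cases k) auto
  show thesis
  proof
    show "below p x ((p ^^ l) x)"
      unfolding below_def by blast
    show "p ((p ^^ l) x) = y"
      using k l by simp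
    show "(p ^^ l) x \<noteq> y"
      using not_less_Least [of l "\<lambda>k. (p ^^ k) x = y"] l k_def by auto
  qed
qed

definition vpath :: "('n \<Rightarrow> 'n) \<Rightarrow> 'n \<Rightarrow> 'n \<Rightarrow> 'n set" where
  "vpath p x y = {u. below p y u \<and> below p u x}"

text \<open>Strict growth of \<open>pos\<close> along proper parent steps is what makes
  \<open>below\<close> antisymmetric. Ties between unrelated nodes are allowed.\<close>

locale numbered_tree =
  fixes N :: "'n set" and p :: "'n \<Rightarrow> 'n" and pos :: "'n \<Rightarrow> nat" and m :: nat
  assumes parent_in: "x \<in> N \<Longrightarrow> p x \<in> N"
    and pos_less_m: "x \<in> N \<Longrightarrow> pos x < m"
    and pos_parent: "x \<in> N \<Longrightarrow> p x \<noteq> x \<Longrightarrow> pos x < pos (p x)"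
begin

lemma below_in: "below p x y \<Longrightarrow> x \<in> N \<Longrightarrow> y \<in> N"
proof -
  have "(p ^^ k) x \<in> N" if "x \<in> N" for k
    using that by (induction k) (auto simp: parent_in)
  then show "below p x y \<Longrightarrow> x \<in> N \<Longrightarrow> y \<in> N"
    unfolding below_def by blast
qed

lemma below_pos:
  assumes "below p x y" "x \<in> N"
  shows "x = y \<or> pos x < pos y"
proof -
  have "(p ^^ k) x \<in> N \<and> ((p ^^ k) x = x \<or> pos x < pos ((p ^^ k) x))" for k
  proof (induction k)
    case (Suc k)
    then show ?case
      using pos_parent [of "(p ^^ k) x"] parent_in [of "(p ^^ k) x"] less_trans by fastforce
  qed (use assms in simp)
  then show ?thesis
    using assms(1) unfolding below_def by metis
qed

lemma below_antisym: "below p x y \<Longrightarrow> below p y x \<Longrightarrow> x \<in> N \<Longrightarrow> x = y"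
  using below_pos [of x y] below_pos [of y x] below_in [of x y] by auto

lemma below_pos_eq: "below p x y \<Longrightarrow> x \<in> N \<Longrightarrow> pos x = pos y \<Longrightarrow> x = y"
  using below_pos by fastforce

lemma siblings_not_below:
  assumes "c \<in> N" "below p c c'" "p c = x" "p c' = x" "c' \<noteq> x"
  shows "c = c'"
proof (rule ccontr)
  assume "c \<noteq> c'"
  with below_step [OF assms(2)] assms(3) have "below p x c'" by simp
  with below_pos [of x c'] parent_in assms have "pos x < pos c'" by auto
  with pos_parent [of c'] below_in assms show False by auto
qed

lemma below_via_child:
  assumes "below p y x" "y \<noteq> x" "y \<in> N"
  obtains c where "below p y c" "p c = x" "c \<noteq> x" "c \<in> N" "pos c < pos x"
  using below_last_step [OF assms(1,2)] below_in assms(3) pos_parent by metis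

text \<open>Order intervals are easier to intersect than climbs cut at the first arrival. A node of
  the interval that is reached only after more than \<open>K\<close> steps lies above
  \<open>t\<close> as well as below it, so antisymmetry makes it \<open>t\<close>.\<close>

lemma downward_path_vpath:
  assumes T: "parent T = p" and b: "b \<in> N" and bt: "below p b t"
  shows "downward_path T t b = vpath p t b"
proof -
  define K where "K = (LEAST k. (p ^^ k) b = t)"
  have K: "(p ^^ K) b = t"
    unfolding K_def using bt unfolding below_def by (rule LeastI_ex)
  have "below p b ((p ^^ i) b) \<and> below p ((p ^^ i) b) t" if "i \<le> K" for i
  proof -
    have "(p ^^ (K - i)) ((p ^^ i) b) = t"
      using that K by (metis comp_apply funpow_add le_add_diff_inverse2)
    then show ?thesis unfolding below_def by blast
  qed
  moreover have "\<exists>i\<le>K. u = (p ^^ i) b" if bu: "below p b u" and ut: "below p u t" for u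
  proof -
    obtain i where i: "(p ^^ i) b = u"
      using bu unfolding below_def by blast
    show ?thesis
    proof (cases "i \<le> K")
      case False
      then have "(p ^^ (i - K)) t = u"
        using i K by (metis comp_apply funpow_add le_add_diff_inverse2 nat_le_linear)
      then have "below p t u" unfolding below_def by blast
      with ut b bt have "u = t"
        using below_antisym below_in by blast
      with K show ?thesis by auto
    qed (use i in auto)
  qed
  ultimately show ?thesis
    unfolding downward_path_def vpath_def T K_def [symmetric] by auto
qed

end

section \<open>Optimality of the bottom-up greedy choice\<close>

locale greedy = numbered_tree N p pos m
  for N :: "'n set" and p pos m +
  fixes n :: nat and t b :: "nat \<Rightarrow> 'n" and best need :: "'n \<Rightarrow> nat"
  assumes top_in: "z < n \<Longrightarrow> t z \<in> N" and bot_in: "z < n \<Longrightarrow> b z \<in> N"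
    and bot_top: "z < n \<Longrightarrow> below p (b z) (t z)"
begin

text \<open>Comparing keys compares tops first; \<open>div n\<close> and \<open>mod n\<close> recover position and vertex.\<close>

definition key :: "nat \<Rightarrow> nat" where
  "key z = Suc (pos (t z)) * n + z"

definition picked :: "'n set" where
  "picked = {x \<in> N. need x = m - pos x}"

definition pick :: "'n \<Rightarrow> nat" where
  "pick x = best x mod n"

text \<open>
  A value \<open>need x = m - q\<close> says that \<open>q\<close> is the lowest position of the top of an undominated vertex
  through \<open>x\<close>, and \<open>need x = m + 1 + q\<close> that some selected path through \<open>x\<close> ends at position \<open>q\<close>; in
  both cases the larger value prevails. Node \<open>x\<close> passes \<open>out x\<close> to its parent.
\<close>

definition out :: "'n \<Rightarrow> nat" where
  "out x = (let v = if need x = m - pos x then m + best x div n else need x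
            in if v = m + 1 + pos x then 0 else v)"

abbreviation path :: "nat \<Rightarrow> 'n set" where
  "path z \<equiv> vpath p (t z) (b z)"

end

text \<open>The tables enter as maxima, each given by upper bounds and attainment with default 0.
  This avoids maxima over empty sets and is exactly what an array filled by repeated
  \<open>max\<close> updates satisfies.\<close>

locale greedy_run = greedy N p pos m n t b best need
  for N :: "'n set" and p pos m n t b best need +
  assumes best_ub: "z < n \<Longrightarrow> x \<in> N \<Longrightarrow> below p (b z) x \<Longrightarrow> key z \<le> best x"
    and best_attained: "x \<in> N \<Longrightarrow> best x = 0 \<or> (\<exists>z<n. below p (b z) x \<and> best x = key z)"
    and need_own: "z < n \<Longrightarrow> m - pos (t z) \<le> need (b z)"
    and need_child: "c \<in> N \<Longrightarrow> p c \<noteq> c \<Longrightarrow> out c \<le> need (p c)"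
    and need_attained: "x \<in> N \<Longrightarrow> need x = 0 \<or> (\<exists>z<n. b z = x \<and> need x = m - pos (t z)) \<or>
      (\<exists>c \<in> N. p c = x \<and> c \<noteq> x \<and> need x = out c)"
begin

lemma top_pos: "z < n \<Longrightarrow> pos (t z) < m"
  using pos_less_m top_in by blast

lemma in_path_in_N: "u \<in> path z \<Longrightarrow> z < n \<Longrightarrow> u \<in> N"
  unfolding vpath_def using below_in bot_in by blast

text \<open>The \<open>Suc\<close> in \<open>key\<close> has two uses: keys are positive, so that 0
  in \<open>best\<close> means that no path has arrived, and \<open>m + key z div n\<close> is
  already the code \<open>m + 1 + pos (t z)\<close> of a path selected up to
  \<open>t z\<close>.\<close>

lemma key_div [simp]: "z < n \<Longrightarrow> key z div n = Suc (pos (t z))"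
  and key_mod [simp]: "z < n \<Longrightarrow> key z mod n = z"
  by (auto simp: key_def simp del: mult_Suc)

text \<open>The vertex \<open>z\<close> with top \<open>x\<close> competes for
  \<open>best x\<close>, so the winner has its top at position \<open>pos x\<close> or later. That
  top and \<open>x\<close> both lie above the winner's bottom and are therefore comparable, which
  puts \<open>x\<close> on the winning path.\<close>

lemma pick_path:
  assumes x: "x \<in> N" and z: "z < n" "x \<in> path z" "t z = x"
  shows "pick x < n" "x \<in> path (pick x)" "best x div n = Suc (pos (t (pick x)))"
proof -
  have "key z \<le> best x"
    using best_ub x z unfolding vpath_def by simp
  moreover have "key z > 0"
    using z(1) by (simp add: key_def)
  ultimately obtain w where w: "w < n" "below p (b w) x" "best x = key w"
    using best_attained [OF x] by auto
  then have pw: "pick x = w"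
    by (simp add: pick_def)
  have "key z div n \<le> key w div n"
    using \<open>key z \<le> best x\<close> w(3) by (simp add: div_le_mono)
  then have le: "pos x \<le> pos (t w)"
    using z w by simp
  have "below p x (t w)"
    using below_comparable [OF w(2) bot_top [OF w(1)]] below_pos [of "t w" x] top_in [OF w(1)] le
    by fastforce
  then show "pick x < n" "x \<in> path (pick x)" "best x div n = Suc (pos (t (pick x)))"
    using w pw by (auto simp: vpath_def)
qed

definition unhit :: "'n \<Rightarrow> nat \<Rightarrow> bool" where
  "unhit x z \<longleftrightarrow> (\<forall>y\<in>picked. below p y x \<longrightarrow> y \<noteq> x \<longrightarrow> path (pick y) \<inter> path z = {})"

text \<open>\<open>need x\<close> is the exact maximum of the codes of selected paths reaching
  \<open>x\<close> from strictly below and of the vertices through \<open>x\<close> not hit from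
  there: two conjuncts say that it is attained, two that it is an upper bound.\<close>

definition dp_inv :: "'n \<Rightarrow> bool" where
  "dp_inv x \<longleftrightarrow>
     (need x > m \<longrightarrow> (\<exists>y\<in>picked. below p y x \<and> y \<noteq> x \<and> x \<in> path (pick y) \<and>
         need x = m + 1 + pos (t (pick y)))) \<and>
     (0 < need x \<and> need x \<le> m \<longrightarrow>
         (\<exists>z<n. x \<in> path z \<and> need x = m - pos (t z) \<and> unhit x z)) \<and>
     (\<forall>y\<in>picked. below p y x \<and> y \<noteq> x \<and> x \<in> path (pick y) \<longrightarrow>
         m + 1 + pos (t (pick y)) \<le> need x) \<and>
     (\<forall>z<n. x \<in> path z \<and> unhit x z \<longrightarrow> m - pos (t z) \<le> need x)"

text \<open>As \<open>pos x < m\<close>, the code \<open>m - pos x\<close> is in the open range.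
  Decoding it gives a vertex through \<open>x\<close> whose top has the position of
  \<open>x\<close>; since its top lies above \<open>x\<close>, it is \<open>x\<close>.\<close>

lemma picked_facts:
  assumes x: "x \<in> picked" and i: "dp_inv x"
  shows "\<exists>z<n. x \<in> path z \<and> t z = x \<and> unhit x z"
    "pick x < n" "x \<in> path (pick x)" "best x div n = Suc (pos (t (pick x)))"
proof -
  have xN: "x \<in> N" and nx: "need x = m - pos x"
    using x unfolding picked_def by auto
  have "0 < need x \<and> need x \<le> m"
    using nx pos_less_m [OF xN] by auto
  then obtain z where z: "z < n" "x \<in> path z" "need x = m - pos (t z)" "unhit x z"
    using i unfolding dp_inv_def by blast
  have "pos x = pos (t z)"
    using z(3) nx pos_less_m [OF xN] top_pos [OF z(1)] by linarith
  then have "t z = x"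
    using below_pos_eq [of x "t z"] z(2) xN unfolding vpath_def by auto
  with z show "\<exists>z<n. x \<in> path z \<and> t z = x \<and> unhit x z" by blast
  show "pick x < n" "x \<in> path (pick x)" "best x div n = Suc (pos (t (pick x)))"
    using pick_path [OF xN z(1,2) \<open>t z = x\<close>] by auto
qed

section \<open>Passing the state from child to parent\<close>

lemma out_if_picked: "x \<in> picked \<Longrightarrow> dp_inv x \<Longrightarrow>
    out x = (if t (pick x) = x then 0 else m + 1 + pos (t (pick x)))"
  using picked_facts [of x] below_pos_eq [of x "t (pick x)"]
  unfolding out_def picked_def by (auto simp: Let_def vpath_def)

lemma out_if_not_picked: "x \<in> N \<Longrightarrow> x \<notin> picked \<Longrightarrow>
    out x = (if need x = m + 1 + pos x then 0 else need x)"
  unfolding out_def picked_def by (auto simp: Let_def)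

lemma path_parent: "z < n \<Longrightarrow> c \<in> path z \<Longrightarrow> t z \<noteq> c \<Longrightarrow> p c \<in> path z"
  unfolding vpath_def using below_step below_parent below_trans by (metis mem_Collect_eq)

lemma out_covered:
  assumes c: "c \<in> N" "dp_inv c" and IH: "\<And>y. below p y c \<Longrightarrow> y \<in> N \<Longrightarrow> dp_inv y" and big: "out c > m"
  shows "\<exists>y\<in>picked. below p y c \<and> p c \<in> path (pick y) \<and> out c = m + 1 + pos (t (pick y))"
proof (cases "c \<in> picked")
  case True
  with picked_facts [OF True c(2)] out_if_picked [OF True c(2)] big show ?thesis
    by (intro bexI [OF _ True]) (auto simp: path_parent split: if_splits)
next
  case False
  then have o: "out c = need c" "need c \<noteq> m + 1 + pos c"
    using out_if_not_picked [OF c(1)] big by (auto split: if_splits)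
  then obtain y where y: "y \<in> picked" "below p y c" "c \<in> path (pick y)"
      "need c = m + 1 + pos (t (pick y))"
    using c(2) big unfolding dp_inv_def by auto
  have "pick y < n"
    using picked_facts(2) IH y(1,2) unfolding picked_def by blast
  then show ?thesis
    using y o path_parent [of "pick y" c] by auto
qed

text \<open>An open code leaving \<open>c\<close> shows that \<open>c\<close> made no selection.
  Hence the top of \<open>z\<close> is not \<open>c\<close>, its path goes on to the parent, and
  there is no selection at \<open>c\<close> that could hit it.\<close>

lemma out_open:
  assumes c: "c \<in> N" "dp_inv c" and small: "0 < out c" "out c \<le> m"
  shows "\<exists>z<n. c \<in> path z \<and> p c \<in> path z \<and> out c = m - pos (t z) \<and>
    (\<forall>y\<in>picked. below p y c \<longrightarrow> path (pick y) \<inter> path z = {})"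
proof -
  have np: "c \<notin> picked"
    using out_if_picked [OF _ c(2)] small by (auto split: if_splits)
  then have o: "out c = need c"
    using out_if_not_picked [OF c(1)] small by (auto split: if_splits)
  then obtain z where z: "z < n" "c \<in> path z" "need c = m - pos (t z)" "unhit c z"
    using c(2) small unfolding dp_inv_def by auto
  have "t z \<noteq> c"
    using np z(3) c(1) unfolding picked_def by auto
  with z o np show ?thesis
    unfolding unhit_def using path_parent by metis
qed

text \<open>A selected path that contains the parent has its top strictly above \<open>c\<close>, so
  its code is not the one that is reset to 0 at \<open>c\<close>.\<close>

lemma out_ge_cover:
  assumes c: "c \<in> N" "dp_inv c" "p c \<noteq> c" and y: "y \<in> picked" "below p y c" "dp_inv y"
    and x: "p c \<in> path (pick y)"
  shows "m + 1 + pos (t (pick y)) \<le> out c"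
proof -
  note yf = picked_facts [OF y(1,3)]
  have ct: "below p (p c) (t (pick y))"
    using x unfolding vpath_def by auto
  have cp: "c \<in> path (pick y)"
    using yf y(2) ct below_parent below_trans unfolding vpath_def by (metis mem_Collect_eq)
  have lt: "pos c < pos (t (pick y))"
    using pos_parent [OF c(1,3)] below_pos [OF ct] parent_in [OF c(1)] by auto
  show ?thesis
  proof (cases "y = c")
    case True
    then show ?thesis
      using out_if_picked [OF y(1,3)] lt by auto
  next
    case False
    then have ge: "m + 1 + pos (t (pick y)) \<le> need c"
      using c(2) y(1,2) cp unfolding dp_inv_def by blast
    then have "c \<notin> picked"
      unfolding picked_def by auto
    then show ?thesis
      using ge lt out_if_not_picked [OF c(1)] by auto
  qed
qed

text \<open>A selection at \<open>c\<close>, or a selected path ending at \<open>c\<close>, would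
  contain \<open>c\<close> and so meet \<open>path z\<close>. Neither exists, so the code of
  \<open>z\<close> is neither replaced nor erased.\<close>

lemma out_ge_open:
  assumes c: "c \<in> N" "dp_inv c" and z: "z < n" "c \<in> path z"
    and d: "\<forall>y\<in>picked. below p y c \<longrightarrow> path (pick y) \<inter> path z = {}"
  shows "m - pos (t z) \<le> out c"
proof -
  have ge: "m - pos (t z) \<le> need c"
    using c(2) z d unfolding dp_inv_def unhit_def by blast
  have np: "c \<notin> picked"
    using d picked_facts(3) [OF _ c(2)] z(2) by (metis below_refl disjoint_iff)
  have "need c \<noteq> m + 1 + pos c"
  proof
    assume "need c = m + 1 + pos c"
    then obtain y where "y \<in> picked" "below p y c" "c \<in> path (pick y)"
      using c(2) unfolding dp_inv_def by auto
    with d z(2) show False by blast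
  qed
  then show ?thesis
    using ge np out_if_not_picked [OF c(1)] by simp
qed

lemma dp_inv_all: "x \<in> N \<Longrightarrow> dp_inv x"
proof (induction "pos x" arbitrary: x rule: less_induct)
  case less
  note xN = less.prems
  have IH: "dp_inv y" if "below p y x" "y \<noteq> x" "y \<in> N" for y
    using less.hyps below_pos that by blast
  have sub: "below p y x \<and> y \<noteq> x" if "below p y c" "p c = x" "c \<noteq> x" "y \<in> N" for y c
    using that below_pos [of y c] below_in [of y c] pos_parent [of c] below_trans below_parent
    by (metis less_irrefl less_trans)
  have pN: "y \<in> N" if "y \<in> picked" for y
    using that unfolding picked_def by auto
  have cover: "m + 1 + pos (t (pick y)) \<le> need x"
    if y: "y \<in> picked" "below p y x" "y \<noteq> x" "x \<in> path (pick y)" for y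
  proof -
    obtain c where c: "below p y c" "p c = x" "c \<noteq> x" "c \<in> N"
      using below_via_child [OF y(2,3) pN [OF y(1)]] by metis
    have "m + 1 + pos (t (pick y)) \<le> out c"
      using out_ge_cover [of c y] c y IH [of c] IH [of y] pN sub [of c c] by auto
    then show ?thesis
      using need_child [of c] c by force
  qed
  have open_: "m - pos (t z) \<le> need x" if z: "z < n" "x \<in> path z" "unhit x z" for z
  proof (cases "b z = x")
    case True
    then show ?thesis using need_own [OF z(1)] by simp
  next
    case False
    then obtain c where c: "below p (b z) c" "p c = x" "c \<noteq> x" "c \<in> N"
      using below_via_child [of "b z" x] z bot_in unfolding vpath_def by (metis mem_Collect_eq)
    have cz: "c \<in> path z"
      using c z(2) below_parent below_trans unfolding vpath_def by (metis mem_Collect_eq)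
    have "\<forall>y\<in>picked. below p y c \<longrightarrow> path (pick y) \<inter> path z = {}"
      using z(3) sub c pN unfolding unhit_def by blast
    then have "m - pos (t z) \<le> out c"
      using out_ge_open [OF c(4) _ z(1) cz] IH [of c] sub [of c c] c by auto
    then show ?thesis
      using need_child [of c] c by force
  qed
  have big: "\<exists>y\<in>picked. below p y x \<and> y \<noteq> x \<and> x \<in> path (pick y) \<and> need x = m + 1 + pos (t (pick y))"
    if "need x > m"
  proof -
    obtain c where c: "c \<in> N" "p c = x" "c \<noteq> x" "need x = out c"
      using need_attained [OF xN] \<open>need x > m\<close> by fastforce
    have "\<exists>y\<in>picked. below p y c \<and> p c \<in> path (pick y) \<and> out c = m + 1 + pos (t (pick y))"
    proof (rule out_covered)
      show "dp_inv y" if "below p y c" "y \<in> N" for y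
        using IH sub [OF that(1) c(2,3) that(2)] that(2) by blast
      then show "dp_inv c" using c(1) by simp
    qed (use c \<open>need x > m\<close> in auto)
    then show ?thesis
      using sub c pN by metis
  qed
  have small: "\<exists>z<n. x \<in> path z \<and> need x = m - pos (t z) \<and> unhit x z"
    if nx: "0 < need x" "need x \<le> m"
  proof -
    have uncovered: "x \<notin> path (pick y)" if "y \<in> picked" "below p y x" "y \<noteq> x" for y
      using cover [OF that] nx by linarith
    have inY: "y \<in> path (pick y) \<and> pick y < n" if "y \<in> picked" "below p y x" "y \<noteq> x" for y
      using picked_facts [OF that(1)] IH that pN by blast
    from need_attained [OF xN] nx consider
        (own) z where "z < n" "b z = x" "need x = m - pos (t z)"
      | (child) c where "c \<in> N" "p c = x" "c \<noteq> x" "need x = out c"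
      by auto
    then show ?thesis
    proof cases
      case own
      \<comment> \<open>Here \<open>path z\<close> starts at \<open>x\<close>. A path selected below
        \<open>x\<close> that meets it climbs to \<open>x\<close> or beyond and thus covers
        \<open>x\<close>, which \<open>need x \<le> m\<close> excludes.\<close>
      have "path (pick y) \<inter> path z = {}" if y: "y \<in> picked" "below p y x" "y \<noteq> x" for y
      proof (rule ccontr)
        assume "path (pick y) \<inter> path z \<noteq> {}"
        then obtain u where "below p x u" "below p u (t (pick y))"
          using own unfolding vpath_def by auto
        then have "x \<in> path (pick y)"
          using inY [OF y] y(2) below_trans unfolding vpath_def by (metis mem_Collect_eq)
        with uncovered [OF y] show False ..
      qed
      then have "unhit x z"
        unfolding unhit_def by blast
      moreover have "x \<in> path z"
        using own bot_top [of z] unfolding vpath_def by auto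
      ultimately show ?thesis
        using own by blast
    next
      case child
      obtain z where z: "z < n" "c \<in> path z" "p c \<in> path z" "out c = m - pos (t z)"
          "\<forall>y\<in>picked. below p y c \<longrightarrow> path (pick y) \<inter> path z = {}"
        using out_open [of c] child nx IH [of c] sub [of c c] by auto
      have "path (pick y) \<inter> path z = {}" if y: "y \<in> picked" "below p y x" "y \<noteq> x" for y
      proof (rule ccontr)
        assume "path (pick y) \<inter> path z \<noteq> {}"
        then obtain u where u: "u \<in> path (pick y)" "u \<in> path z" by auto
        obtain c' where c': "below p y c'" "p c' = x" "c' \<noteq> x" "c' \<in> N"
          using below_via_child [OF y(2,3) pN [OF y(1)]] by metis
        have yt: "below p y (t (pick y))" and by': "below p (b (pick y)) y"
          using inY [OF y] unfolding vpath_def by auto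
        \<comment> \<open>The danger is a selection in the branch of another child
          \<open>c'\<close>. As it does not cover \<open>x\<close>, it stays inside that branch, so
          the meeting node \<open>u\<close> lies below \<open>c'\<close>. But \<open>u\<close>
          shares \<open>path z\<close> with \<open>c\<close>, which makes the siblings
          \<open>c\<close> and \<open>c'\<close> comparable and hence equal.\<close>
        have "\<not> below p x (t (pick y))"
          using uncovered [OF y] y(2) by' below_trans unfolding vpath_def by (metis mem_Collect_eq)
        then have "below p (t (pick y)) c'"
          using below_comparable [OF c'(1) yt] below_step c'(2) by (metis below_refl)
        then have uc': "below p u c'"
          using u(1) below_trans unfolding vpath_def by (metis mem_Collect_eq)
        have uN: "u \<in> N"
          using in_path_in_N u(2) z(1) by blast
        have "below p u c \<or> below p c u"
          using u(2) z(2) below_comparable unfolding vpath_def by (metis mem_Collect_eq)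
        then have "below p c c' \<or> below p c' c"
          using uc' below_trans below_comparable by metis
        then have "c = c'"
          using siblings_not_below [of c c' x] siblings_not_below [of c' c x] c' child by auto
        with z(5) y(1) c'(1) u show False by blast
      qed
      then show ?thesis
        using z child unfolding unhit_def by auto
    qed
  qed
  show ?case
    unfolding dp_inv_def using big small cover open_ by blast
qed

section \<open>Domination and the matching lower bound\<close>

lemmas picked_all = picked_facts [OF _ dp_inv_all]

text \<open>At \<open>x = t z\<close> an undominated \<open>z\<close> forces \<open>need x\<close>
  to be an open code of at least \<open>m - pos x\<close>. Open vertices through \<open>x\<close>
  have tops at \<open>x\<close> or above, so no such code exceeds \<open>m - pos x\<close>; thus
  \<open>x\<close> triggers a selection, and the selected path contains \<open>x\<close>.\<close>

lemma pick_dominates: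
  assumes z: "z < n"
  shows "\<exists>y\<in>picked. path (pick y) \<inter> path z \<noteq> {}"
proof (rule ccontr)
  assume neg: "\<not> ?thesis"
  define x where "x = t z"
  have xN: "x \<in> N" and xz: "x \<in> path z"
    using z top_in bot_top unfolding x_def vpath_def by auto
  note i = dp_inv_all [OF xN]
  have "m - pos x \<le> need x"
    using i z xz neg unfolding dp_inv_def unhit_def x_def by blast
  moreover have "need x \<le> m"
    using i xz neg unfolding dp_inv_def by (meson disjoint_iff not_le)
  moreover have "0 < m - pos x"
    using pos_less_m [OF xN] by simp
  ultimately obtain z' where z': "z' < n" "x \<in> path z'" "need x = m - pos (t z')"
    using i unfolding dp_inv_def by (metis less_le_trans)
  have "pos x \<le> pos (t z')"
    using below_pos [of x "t z'"] z'(2) xN unfolding vpath_def by auto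
  with z'(3) \<open>m - pos x \<le> need x\<close> have "x \<in> picked"
    unfolding picked_def using xN by auto
  with picked_all(3) [OF this xN] xz neg show False by blast
qed

text \<open>Two triggering vertices have no common dominator \<open>u\<close>. The third hypothesis
  is an ordering without loss of generality; it includes ties because positions are not assumed
  injective.\<close>

lemma packing:
  assumes xy: "x \<in> picked" "y \<in> picked" "pos x < pos y \<or> x \<noteq> y \<and> pos x = pos y"
    and zx: "zx < n" "t zx = x" and zy: "zy < n" "t zy = y" "unhit y zy"
    and u: "u < n" "path u \<inter> path zx \<noteq> {}" "path u \<inter> path zy \<noteq> {}"
  shows False
proof -
  have N: "x \<in> N" "y \<in> N"
    using xy unfolding picked_def by auto
  note wx = picked_all(2-4) [OF xy(1) N(1)]
  have nyx: "\<not> below p y x"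
    using below_pos [of y x] xy(3) N by auto
  obtain a where a: "below p (b u) a" "below p a (t u)" "below p (b zx) a" "below p a x"
    using u(2) zx(2) unfolding vpath_def by auto
  obtain c where c: "below p (b u) c" "below p c (t u)" "below p (b zy) c" "below p c y"
    using u(3) zy(2) unfolding vpath_def by auto
  have "below p x y \<or> below p y x"
    using below_comparable [OF a(1) c(1)] below_trans [OF _ a(4)] below_trans [OF _ c(4)]
      below_comparable a(4) c(4) by metis
  then have xy': "below p x y" "x \<noteq> y"
    using nyx by auto
  \<comment> \<open>The node \<open>c\<close> is where \<open>u\<close> meets
    \<open>path zy\<close>. If \<open>c\<close> is above \<open>x\<close>, then \<open>u\<close>
    passes through \<open>x\<close> and competed there, so the selected path reaches at least as
    high as \<open>u\<close> and contains \<open>c\<close>. Otherwise \<open>path zy\<close> climbs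
    from below \<open>x\<close> to \<open>y\<close> above it and contains \<open>x\<close>
    itself.\<close>
  have "path (pick x) \<inter> path zy \<noteq> {}"
  proof (cases "below p x c")
    case True
    have "below p x (t u)"
      using True c(2) below_trans by metis
    have "key u \<le> best x"
      using best_ub [OF u(1) N(1)] below_trans [OF a(1,4)] by simp
    then have "key u div n \<le> best x div n" by (rule div_le_mono)
    then have "pos (t u) \<le> pos (t (pick x))"
      using wx u(1) by simp
    moreover have "below p (t u) (t (pick x)) \<or> below p (t (pick x)) (t u)"
      using below_comparable [of p x] \<open>below p x (t u)\<close> wx unfolding vpath_def by auto
    ultimately have "below p (t u) (t (pick x))"
      using below_pos [of "t (pick x)" "t u"] top_in wx(1) by auto
    then have "c \<in> path (pick x)"
      using wx(2) True c(2) below_trans unfolding vpath_def by (metis mem_Collect_eq)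
    moreover have "c \<in> path zy"
      using c zy unfolding vpath_def by auto
    ultimately show ?thesis by blast
  next
    case False
    have "below p c x"
      using below_comparable [OF a(1) c(1)] below_comparable [OF a(4)] a(4) False below_trans by metis
    then have "x \<in> path zy"
      using c(3) xy'(1) zy(2) below_trans unfolding vpath_def by (metis mem_Collect_eq)
    with wx(2) show ?thesis by blast
  qed
  with zy(3) xy(1) xy' show False
    unfolding unhit_def by blast
qed

theorem minimum:
  assumes V: "pverts G = {..<n}" and fN: "finite N"
    and E: "\<And>z w. z < n \<Longrightarrow> w < n \<Longrightarrow> z \<noteq> w \<Longrightarrow> (z, w) \<in> parcs G \<longleftrightarrow> path z \<inter> path w \<noteq> {}"
  shows "minimum_dominating_set G (pick ` picked)"
proof -
  have fp: "finite picked"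
    using fN unfolding picked_def by simp
  have pN: "y \<in> N" if "y \<in> picked" for y
    using that unfolding picked_def by auto
  have "dominating_set G (pick ` picked)"
    unfolding dominating_set_def V
  proof (intro conjI ballI)
    show "pick ` picked \<subseteq> {..<n}"
      using picked_all(2) pN by auto
    fix v assume "v \<in> {..<n}"
    then have v: "v < n" by simp
    obtain y where y: "y \<in> picked" "path (pick y) \<inter> path v \<noteq> {}"
      using pick_dominates [OF v] by blast
    then show "v \<in> pick ` picked \<or> (\<exists>u\<in>pick ` picked. (v, u) \<in> parcs G)"
      using E [OF v picked_all(2) [OF y(1) pN [OF y(1)]]] by (metis Int_commute imageI)
  qed
  moreover have "card (pick ` picked) \<le> card S" if S: "dominating_set G S" for S
  proof -
    have fS: "finite S"
      using S V finite_subset unfolding dominating_set_def by (metis finite_lessThan)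
    obtain zz where zz: "\<And>x. x \<in> picked \<Longrightarrow> zz x < n \<and> t (zz x) = x \<and> unhit x (zz x)"
      using picked_all(1) pN by metis
    have "\<exists>u\<in>S. u < n \<and> path u \<inter> path (zz x) \<noteq> {}" if "x \<in> picked" for x
    proof -
      \<comment> \<open>A nonempty path meets itself; this settles the case that \<open>S\<close>
        contains \<open>zz x\<close>, where no edge is available.\<close>
      have "t (zz x) \<in> path (zz x)"
        using bot_top [of "zz x"] zz [OF that] unfolding vpath_def by auto
      then show ?thesis
        using S zz [OF that] E [of "zz x"] unfolding dominating_set_def V
        by (metis Int_commute Int_absorb empty_iff lessThan_iff subset_iff)
    qed
    then obtain f where f: "\<And>x. x \<in> picked \<Longrightarrow> f x \<in> S \<and> f x < n \<and> path (f x) \<inter> path (zz x) \<noteq> {}"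
      by metis
    have "inj_on f picked"
    proof (rule inj_onI, rule ccontr)
      fix x y assume xy: "x \<in> picked" "y \<in> picked" "f x = f y" "x \<noteq> y"
      then consider "pos x < pos y \<or> x \<noteq> y \<and> pos x = pos y" | "pos y < pos x"
        by linarith
      then show False
        using packing [of x y "zz x" "zz y" "f x"] packing [of y x "zz y" "zz x" "f x"]
          xy zz [OF xy(1)] zz [OF xy(2)] f [OF xy(1)] f [OF xy(2)] by cases auto
    qed
    then have "card picked \<le> card S"
      using card_inj_on_le [of f picked S] f fS by blast
    then show ?thesis
      using card_image_le [OF fp, of pick] by linarith
  qed
  ultimately show ?thesis
    unfolding minimum_dominating_set_def by blast
qed

end

section \<open>Leaf peeling\<close>

definition children :: "(nat \<Rightarrow> nat) \<Rightarrow> nat \<Rightarrow> nat \<Rightarrow> nat set" where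
  "children p m x = {c. c < m \<and> p c = x \<and> c \<noteq> x}"

text \<open>The invariant of Kahn's topological sorting: \<open>L\<close> is the queue, its first
  \<open>j\<close> entries have been removed, those from \<open>j\<close> up to \<open>q\<close> are
  waiting, and \<open>deg\<close> counts the children not yet removed.\<close>

definition peeling :: "(nat \<Rightarrow> nat) \<Rightarrow> nat \<Rightarrow> nat \<Rightarrow> nat \<Rightarrow> (nat \<Rightarrow> nat) \<Rightarrow> (nat \<Rightarrow> nat) \<Rightarrow> (nat \<Rightarrow> nat) \<Rightarrow> bool" where
  "peeling p m j q deg L pos \<longleftrightarrow>
     j \<le> q \<and> inj_on L {..<q} \<and> L ` {..<q} \<subseteq> {..<m} \<and>
     (\<forall>x<m. deg x = card (children p m x - L ` {..<j})) \<and>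
     (\<forall>x<m. deg x = 0 \<longleftrightarrow> x \<in> L ` {..<q}) \<and>
     (\<forall>i<q. children p m (L i) \<subseteq> L ` {..<i}) \<and> (\<forall>i<j. pos (L i) = i)"

definition bottom_up :: "(nat \<Rightarrow> nat) \<Rightarrow> nat \<Rightarrow> (nat \<Rightarrow> nat) \<Rightarrow> (nat \<Rightarrow> nat) \<Rightarrow> bool" where
  "bottom_up p m L pos \<longleftrightarrow>
     (\<forall>i<m. L i < m \<and> pos (L i) = i) \<and> (\<forall>x<m. pos x < m \<and> L (pos x) = x) \<and>
     (\<forall>x<m. p x \<noteq> x \<longrightarrow> pos x < pos (p x))"

locale parent_array =
  fixes p :: "nat \<Rightarrow> nat" and m r :: nat
  assumes parent_less: "x < m \<Longrightarrow> p x < m"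
    and root_parent: "p r = r"
    and reaches_root: "x < m \<Longrightarrow> below p x r"
begin

lemma finite_children [simp]: "finite (children p m x)"
  unfolding children_def by simp

text \<open>Take a node of \<open>U\<close> at the greatest distance from the root: a child of it is
  one step farther away and cannot lie in \<open>U\<close>.\<close>

lemma child_free_exists:
  assumes "U \<subseteq> {..<m}" "U \<noteq> {}"
  shows "\<exists>x\<in>U. children p m x \<inter> U = {}"
proof -
  define d where "d x = (LEAST k. (p ^^ k) x = r)" for x
  have "finite U" using assms(1) finite_subset by blast
  then have "Max (d ` U) \<in> d ` U" and le: "\<And>y. y \<in> U \<Longrightarrow> d y \<le> Max (d ` U)"
    using assms(2) by simp_all
  then obtain x where x: "x \<in> U" "Max (d ` U) = d x"
    by blast
  have "c \<notin> U" if c: "c \<in> children p m x" for c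
  proof
    assume "c \<in> U"
    have cm: "c < m" "p c = x" "c \<noteq> x"
      using c unfolding children_def by auto
    have dc: "(p ^^ d c) c = r"
      unfolding d_def using reaches_root [OF cm(1)] unfolding below_def by (rule LeastI_ex)
    have "c \<noteq> r" using cm root_parent by auto
    with dc obtain k where k: "d c = Suc k"
      by (cases "d c") auto
    with dc cm(2) have "(p ^^ k) x = r"
      by (simp add: funpow_swap1)
    then have "d x \<le> k"
      unfolding d_def by (rule Least_le)
    with le [OF \<open>c \<in> U\<close>] x(2) k show False by simp
  qed
  with x(1) show ?thesis by blast
qed

text \<open>If the queue ran dry early, some remaining node would have only removed children, hence
  degree 0, and would have been enqueued.\<close>

lemma peeling_progress:
  assumes P: "peeling p m j q deg L pos" and j: "j < m"
  shows "j < q"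
proof (rule ccontr)
  assume "\<not> j < q"
  then have q: "q = j"
    using P unfolding peeling_def by simp
  define U where "U = {..<m} - L ` {..<q}"
  have "card (L ` {..<q}) < m"
    using card_image_le [of "{..<q}" L] q j by simp
  then have "U \<noteq> {}"
    unfolding U_def using card_mono [of "L ` {..<q}" "{..<m}"] by auto
  then obtain x where x: "x \<in> U" "children p m x \<inter> U = {}"
    using child_free_exists [of U] unfolding U_def by blast
  then have "children p m x - L ` {..<j} = {}"
    unfolding U_def children_def q by auto
  then have "x \<in> L ` {..<q}"
    using P x(1) unfolding peeling_def U_def by (metis Diff_iff card.empty lessThan_iff)
  with x(1) show False unfolding U_def by simp
qed

lemma peeling_queue_le: "peeling p m j q deg L pos \<Longrightarrow> q \<le> m"
  unfolding peeling_def using card_inj_on_le [of L "{..<q}" "{..<m}"] by simp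

lemma peeling_init:
  assumes deg: "\<And>x. x < m \<Longrightarrow> deg x = card (children p m x)"
    and L: "inj_on L {..<q}" "L ` {..<q} = {x. x < m \<and> deg x = 0}"
  shows "peeling p m 0 q deg L pos"
proof -
  have "children p m (L i) = {}" if "i < q" for i
  proof -
    have "L i < m \<and> deg (L i) = 0"
      using L(2) that by auto
    then show ?thesis
      using deg [of "L i"] by simp
  qed
  then show ?thesis
    unfolding peeling_def using deg L by auto
qed

text \<open>The parent is always written behind the end of the queue and counts only if the length
  grows, so the update needs no branch. The factor \<open>y \<noteq> L j\<close> keeps the root from
  being counted as its own child; the second claim excludes a truncated subtraction.\<close>

lemma peeling_step:
  assumes P: "peeling p m j q deg L pos" and j: "j < m"
    and y: "y = p (L j)" and d: "d = deg y - of_bool (y \<noteq> L j)"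
  shows "peeling p m (Suc j) (q + of_bool (d = 0 \<and> y \<noteq> L j)) (deg(y := d)) (L(q := y)) (pos(L j := j))"
    and "y \<noteq> L j \<Longrightarrow> deg y > 0"
proof -
  define x where "x = L j"
  have jq: "j < q"
    using peeling_progress [OF P j] .
  note P' = P [unfolded peeling_def]
  note inj = P' [THEN conjunct2, THEN conjunct1]
    and range = P' [THEN conjunct2, THEN conjunct2, THEN conjunct1]
    and deg = P' [THEN conjunct2, THEN conjunct2, THEN conjunct2, THEN conjunct1, rule_format]
    and zero = P' [THEN conjunct2, THEN conjunct2, THEN conjunct2, THEN conjunct2, THEN conjunct1, rule_format]
    and order = P' [THEN conjunct2, THEN conjunct2, THEN conjunct2, THEN conjunct2, THEN conjunct2,
        THEN conjunct1, rule_format]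
    and pos = P' [THEN conjunct2, THEN conjunct2, THEN conjunct2, THEN conjunct2, THEN conjunct2,
        THEN conjunct2, rule_format]
  have x: "x < m" "y < m" "p x = y"
    using range jq parent_less y unfolding x_def by auto
  have xn: "x \<notin> L ` {..<j}"
    using inj_on_image_mem_iff [OF inj, of j "{..<j}"] jq unfolding x_def by auto
  have Lj: "L ` {..<Suc j} = insert x (L ` {..<j})"
    unfolding x_def lessThan_Suc by auto
  have child: "x \<in> children p m z \<longleftrightarrow> z = y \<and> y \<noteq> x" for z
    unfolding children_def using x by auto
  have deg': "(deg(y := d)) z = card (children p m z - L ` {..<Suc j})" if "z < m" for z
  proof -
    have "children p m z - L ` {..<Suc j} = (children p m z - L ` {..<j}) - {x}"
      unfolding Lj by auto
    moreover have "card ((children p m z - L ` {..<j}) - {x}) = deg z - of_bool (z = y \<and> y \<noteq> x)"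
      using deg [OF that] xn child [of z] by (auto simp: card_Diff_singleton_if)
    ultimately show ?thesis
      using d unfolding x_def by auto
  qed
  show pos_deg: "y \<noteq> L j \<Longrightarrow> deg y > 0"
    using deg [OF x(2)] child [of y] xn unfolding x_def by (auto simp: card_gt_0_iff)
  define new where "new = (d = 0 \<and> y \<noteq> x)"
  \<comment> \<open>A parent that enters the queue now had positive degree before, so it is not
    there already; this preserves injectivity.\<close>
  have newd: "new \<Longrightarrow> y \<notin> L ` {..<q}"
    using pos_deg zero [OF x(2)] unfolding new_def x_def by auto
  have img: "L(q := y) ` {..<i} = L ` {..<i}" if "i \<le> q" for i
    using that by (intro image_cong) auto
  have Lq: "L(q := y) ` {..<q + of_bool new} = L ` {..<q} \<union> (if new then {y} else {})"
    using img [of q] by (auto simp: lessThan_Suc)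
  have "peeling p m (Suc j) (q + of_bool new) (deg(y := d)) (L(q := y)) (pos(x := j))"
    unfolding peeling_def
  proof (intro conjI allI impI)
    show "Suc j \<le> q + of_bool new" using jq by simp
    have "inj_on (L(q := y)) {..<q}"
      using inj by (auto simp: inj_on_def)
    then show "inj_on (L(q := y)) {..<q + of_bool new}"
      using newd img [of q] by (auto simp: lessThan_Suc inj_on_insert)
    show "L(q := y) ` {..<q + of_bool new} \<subseteq> {..<m}"
      unfolding Lq using range x by auto
    show "(deg(y := d)) z = card (children p m z - L(q := y) ` {..<Suc j})" if "z < m" for z
      using deg' [OF that] img [of "Suc j"] jq by simp
    show "(deg(y := d)) z = 0 \<longleftrightarrow> z \<in> L(q := y) ` {..<q + of_bool new}" if z: "z < m" for z
    proof (cases "z = y")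
      case True
      have "d = 0 \<longleftrightarrow> y \<in> L ` {..<q} \<or> new"
      proof (cases "y = x")
        case True
        then show ?thesis
          using zero [OF x(2)] d unfolding new_def x_def by auto
      next
        case False
        then have "y \<notin> L ` {..<q}"
          using pos_deg zero [OF x(2)] unfolding x_def by auto
        with False show ?thesis
          unfolding new_def by auto
      qed
      then show ?thesis
        unfolding Lq True by auto
    next
      case False
      then show ?thesis
        unfolding Lq using zero [OF z] by auto
    qed
    show "children p m ((L(q := y)) i) \<subseteq> L(q := y) ` {..<i}" if i: "i < q + of_bool new" for i
    proof (cases "i = q")
      case True
      with i have new by (cases new) auto
      then have "card (children p m y - L ` {..<Suc j}) = 0"
        using deg' [OF x(2)] unfolding new_def by simp
      then have "children p m y \<subseteq> L ` {..<Suc j}"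
        by simp
      also have "\<dots> \<subseteq> L ` {..<q}"
        using jq by auto
      finally show ?thesis
        using True img [of q] by simp
    next
      case False
      then have "i < q" using i by (cases new) auto
      then show ?thesis
        using order img [of i] by simp
    qed
    show "(pos(x := j)) ((L(q := y)) i) = i" if "i < Suc j" for i
      using that pos jq inj_onD [OF inj, of i j] unfolding x_def by (auto simp: less_Suc_eq)
  qed
  then show "peeling p m (Suc j) (q + of_bool (d = 0 \<and> y \<noteq> L j)) (deg(y := d)) (L(q := y)) (pos(L j := j))"
    unfolding new_def x_def .
qed

lemma peeling_final:
  assumes P: "peeling p m m q deg L pos"
  shows "bottom_up p m L pos"
proof -
  have q: "q = m"
    using peeling_queue_le [OF P] P unfolding peeling_def by auto
  have "L ` {..<m} = {..<m}"
    using P card_subset_eq [of "{..<m}" "L ` {..<m}"] unfolding peeling_def q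
    by (simp add: card_image)
  moreover have pos: "pos (L i) = i" if "i < m" for i
    using P that unfolding peeling_def by auto
  ultimately have inv: "pos x < m \<and> L (pos x) = x" if "x < m" for x
    using that by (metis imageE lessThan_iff)
  have "pos x < pos (p x)" if "x < m" "p x \<noteq> x" for x
  proof -
    have "x \<in> children p m (L (pos (p x)))" "pos (p x) < q"
      using inv [OF parent_less [OF that(1)]] that q unfolding children_def by auto
    then obtain i where "i < pos (p x)" "x = L i"
      using P unfolding peeling_def by blast
    then show ?thesis
      using pos [of i] \<open>pos (p x) < q\<close> q by simp
  qed
  then show ?thesis
    unfolding bottom_up_def using pos inv \<open>L ` {..<m} = {..<m}\<close> by auto
qed

end

section \<open>The dynamic program as a recurrence on arrays\<close>

text \<open>\<open>V\<close> arises from \<open>v0\<close> by the updates \<open>V[tgt i] := max V[tgt i] (val i)\<close> for \<open>i < j\<close>.\<close>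

definition scatter_max ::
  "('n \<Rightarrow> nat) \<Rightarrow> (nat \<Rightarrow> 'n) \<Rightarrow> (nat \<Rightarrow> nat) \<Rightarrow> nat \<Rightarrow> ('n \<Rightarrow> nat) \<Rightarrow> bool" where
  "scatter_max v0 tgt val j V \<longleftrightarrow>
     (\<forall>x. v0 x \<le> V x) \<and> (\<forall>i<j. val i \<le> V (tgt i)) \<and>
     (\<forall>x. V x = v0 x \<or> (\<exists>i<j. tgt i = x \<and> V x = val i))"

lemma scatter_max_0: "scatter_max v0 tgt val 0 v0"
  unfolding scatter_max_def by simp

lemma scatter_max_Suc:
  assumes "scatter_max v0 tgt val j V" "x = tgt j" "v = val j"
  shows "scatter_max v0 tgt val (Suc j) (V(x := max (V x) v))"
  unfolding scatter_max_def
proof (intro conjI allI impI)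
  show "v0 y \<le> (V(x := max (V x) v)) y" for y
    using assms(1) unfolding scatter_max_def by (simp add: le_max_iff_disj)
  show "val i \<le> (V(x := max (V x) v)) (tgt i)" if "i < Suc j" for i
    using assms that unfolding scatter_max_def by (auto simp: less_Suc_eq le_max_iff_disj)
  show "(V(x := max (V x) v)) y = v0 y \<or> (\<exists>i<Suc j. tgt i = y \<and> (V(x := max (V x) v)) y = val i)" for y
    using assms unfolding scatter_max_def by (auto simp: less_Suc_eq max_def)
qed

lemma scatter_max_le:
  assumes "scatter_max v0 tgt val j V" "\<And>x. v0 x \<le> K" "\<And>i. i < j \<Longrightarrow> val i \<le> K"
  shows "V x \<le> K"
  using assms unfolding scatter_max_def by metis

text \<open>Step \<open>j\<close> reads the entries of \<open>L j\<close> and pushes to its parent.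
  At the root the parent entry is its own, but it changes only after it has been read. The mark is
  written in every step, with a bit that is 0 if there is no selection.\<close>

primrec dp :: "(nat \<Rightarrow> nat) \<Rightarrow> nat \<Rightarrow> nat \<Rightarrow> (nat \<Rightarrow> nat) \<Rightarrow> (nat \<Rightarrow> nat) \<Rightarrow> (nat \<Rightarrow> nat) \<Rightarrow> nat \<Rightarrow>
    (nat \<Rightarrow> nat) \<times> (nat \<Rightarrow> nat) \<times> (nat \<Rightarrow> nat)" where
  "dp p m n L best0 need0 0 = (best0, need0, \<lambda>_. 0)"
| "dp p m n L best0 need0 (Suc j) =
     (case dp p m n L best0 need0 j of (best, need, sel) \<Rightarrow>
       let x = L j; y = p x; k = best x;
         v = (if need x = m - j then m + k div n else need x);
         v' = (if v = m + 1 + j then 0 else v)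
       in (best(y := max (best y) k), need(y := max (need y) v'),
           sel(k mod n := or (sel (k mod n)) (of_bool (need x = m - j)))))"

locale dp_input = parent_array +
  fixes n :: nat and t b :: "nat \<Rightarrow> nat" and L pos best0 need0 :: "nat \<Rightarrow> nat"
  assumes n_pos: "0 < n"
    and top_less: "z < n \<Longrightarrow> t z < m" and bot_less: "z < n \<Longrightarrow> b z < m"
    and bot_below_top: "z < n \<Longrightarrow> below p (b z) (t z)"
    and order: "bottom_up p m L pos"
    and best0: "scatter_max (\<lambda>_. 0) b (\<lambda>z. Suc (pos (t z)) * n + z) n best0"
    and need0: "scatter_max (\<lambda>_. 0) b (\<lambda>z. m - pos (t z)) n need0"
begin

abbreviation "state j \<equiv> dp p m n L best0 need0 j"
abbreviation "bestA j \<equiv> fst (state j)"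
abbreviation "needA j \<equiv> fst (snd (state j))"
abbreviation "selA j \<equiv> snd (snd (state j))"

text \<open>These are the values at the moment when \<open>x\<close> is processed, after all its
  children have pushed theirs.\<close>

definition best :: "nat \<Rightarrow> nat" where "best x = bestA (pos x) x"
definition need :: "nat \<Rightarrow> nat" where "need x = needA (pos x) x"

lemma L_less: "i < m \<Longrightarrow> L i < m" and pos_L: "i < m \<Longrightarrow> pos (L i) = i"
  and pos_less: "x < m \<Longrightarrow> pos x < m" and L_pos: "x < m \<Longrightarrow> L (pos x) = x"
  and pos_less_parent: "x < m \<Longrightarrow> p x \<noteq> x \<Longrightarrow> pos x < pos (p x)"
  using order unfolding bottom_up_def by auto

sublocale greedy "{..<m}" p pos m n t b best need
  by unfold_locales (auto simp: parent_less pos_less pos_less_parent top_less bot_less bot_below_top)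

text \<open>Step \<open>i\<close> processes the node of position \<open>i\<close>, so the value it
  pushes is by definition the recorded one. The recurrence thereby becomes a scatter of values that
  no longer depend on the state.\<close>

lemma scatter_best: "j \<le> m \<Longrightarrow> scatter_max best0 (\<lambda>i. p (L i)) (\<lambda>i. best (L i)) j (bestA j)"
proof (induction j)
  case (Suc j)
  have "bestA (Suc j) = (bestA j)(p (L j) := max (bestA j (p (L j))) (best (L j)))"
    using Suc.prems pos_L [of j] unfolding best_def by (simp add: Let_def split_beta)
  then show ?case
    using scatter_max_Suc [OF Suc.IH refl refl] Suc.prems by (metis Suc_leD)
qed (simp add: scatter_max_0)

lemma scatter_need: "j \<le> m \<Longrightarrow> scatter_max need0 (\<lambda>i. p (L i)) (\<lambda>i. out (L i)) j (needA j)"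
proof (induction j)
  case (Suc j)
  have "needA (Suc j) = (needA j)(p (L j) := max (needA j (p (L j))) (out (L j)))"
    using Suc.prems pos_L [of j] unfolding best_def need_def out_def
    by (simp add: Let_def split_beta)
  then show ?case
    using scatter_max_Suc [OF Suc.IH refl refl] Suc.prems by (metis Suc_leD)
qed (simp add: scatter_max_0)

lemma own_key: "z < n \<Longrightarrow> key z \<le> best (b z)"
  using best0 scatter_best [of "pos (b z)"] pos_less [OF bot_less]
  unfolding scatter_max_def best_def key_def by (meson le_trans less_imp_le)

lemma best_parent:
  assumes "c < m" shows "best c \<le> best (p c)"
proof (cases "p c = c")
  case False
  then show ?thesis
    using scatter_best [of "pos (p c)"] pos_less_parent [OF assms] pos_less parent_less assms L_pos [OF assms]
    unfolding scatter_max_def best_def [of "p c"] by (metis less_imp_le)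
qed simp

lemma best_le_ancestor:
  assumes "below p x y" "x < m" shows "best x \<le> best y"
proof -
  have "(p ^^ k) x < m \<and> best x \<le> best ((p ^^ k) x)" for k
  proof (induction k)
    case (Suc k)
    then show ?case
      using best_parent [of "(p ^^ k) x"] parent_less by fastforce
  qed (use assms in simp)
  then show ?thesis
    using assms(1) unfolding below_def by blast
qed

lemma best_is_key: "x < m \<Longrightarrow> best x = 0 \<or> (\<exists>z<n. below p (b z) x \<and> best x = key z)"
proof (induction "pos x" arbitrary: x rule: less_induct)
  case less
  from scatter_best [of "pos x"] pos_less [OF less.prems]
  consider "best x = best0 x" | i where "i < pos x" "p (L i) = x" "best x = best (L i)"
    unfolding scatter_max_def best_def by (metis less_imp_le)
  then show ?case
  proof cases
    case 1
    then show ?thesis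
      using best0 unfolding scatter_max_def key_def by (metis below_refl)
  next
    case 2
    then have "L i < m" "pos (L i) < pos x"
      using pos_less [OF less.prems] L_less [of i] pos_L [of i] by auto
    from less.hyps [OF this(2,1)] 2 show ?thesis
      using below_parent below_trans by metis
  qed
qed

lemma need_cases:
  assumes "x < m"
  shows "need x = need0 x \<or> (\<exists>i<pos x. p (L i) = x \<and> need x = out (L i))"
  using scatter_need [of "pos x"] pos_less [OF assms]
  unfolding scatter_max_def need_def [of x] by simp

sublocale greedy_run "{..<m}" p pos m n t b best need
proof unfold_locales
  fix z x assume "z < n" "x \<in> {..<m}" "below p (b z) x"
  then show "key z \<le> best x"
    using own_key best_le_ancestor bot_less le_trans by metis
next
  fix x assume "x \<in> {..<m}"
  then show "best x = 0 \<or> (\<exists>z<n. below p (b z) x \<and> best x = key z)"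
    using best_is_key by simp
next
  fix z assume "z < n"
  then show "m - pos (t z) \<le> need (b z)"
    using need0 scatter_need [of "pos (b z)"] pos_less [OF bot_less]
    unfolding scatter_max_def need_def by (meson le_trans less_imp_le)
next
  fix c assume "c \<in> {..<m}" "p c \<noteq> c"
  then show "out c \<le> need (p c)"
    using scatter_need [of "pos (p c)"] pos_less_parent [of c] pos_less [of "p c"] parent_less [of c] L_pos [of c]
    unfolding scatter_max_def need_def [of "p c"] by (metis lessThan_iff less_imp_le)
next
  fix x assume "x \<in> {..<m}"
  then have x: "x < m" by simp
  from need_cases [OF x]
  consider "need x = need0 x" | i where "i < pos x" "p (L i) = x" "need x = out (L i)"
    by blast
  then show "need x = 0 \<or> (\<exists>z<n. b z = x \<and> need x = m - pos (t z)) \<or>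
      (\<exists>c \<in> {..<m}. p c = x \<and> c \<noteq> x \<and> need x = out c)"
  proof cases
    case 1
    then show ?thesis
      using need0 unfolding scatter_max_def by metis
  next
    case 2
    then have "L i < m" "L i \<noteq> x"
      using pos_less [OF x] L_less [of i] pos_L [of i] by auto
    with 2 show ?thesis by blast
  qed
qed

lemma selA_eq:
  "j \<le> m \<Longrightarrow> selA j v = of_bool (\<exists>i<j. L i \<in> picked \<and> pick (L i) = v)"
proof (induction j)
  case (Suc j)
  have "L j \<in> picked \<longleftrightarrow> needA j (L j) = m - j"
    using Suc.prems L_less [of j] pos_L [of j] unfolding picked_def need_def by simp
  moreover have "pick (L j) = bestA j (L j) mod n"
    using Suc.prems pos_L [of j] unfolding pick_def best_def by simp
  ultimately have "selA (Suc j) v = (if pick (L j) = v then or (selA j v) (of_bool (L j \<in> picked)) else selA j v)"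
    by (simp add: Let_def split_beta)
  then show ?case
    using Suc by (auto simp: less_Suc_eq)
qed simp

lemma selected: "{v. v < n \<and> selA m v = 1} = pick ` picked"
proof -
  have "v \<in> pick ` picked \<longleftrightarrow> (\<exists>i<m. L i \<in> picked \<and> pick (L i) = v)" for v
    unfolding image_iff using L_pos pos_less unfolding picked_def
    by (metis (no_types, lifting) lessThan_iff mem_Collect_eq)
  moreover have "pick y < n" for y
    using n_pos unfolding pick_def by simp
  ultimately show ?thesis
    unfolding selA_eq [OF order_refl] by auto
qed

section \<open>Bounds on the tables, which later exclude overflow\<close>

lemma key_less: "z < n \<Longrightarrow> key z < Suc m * n"
proof -
  assume z: "z < n"
  have "Suc (pos (t z)) * n \<le> m * n"
    using pos_less [OF top_less [OF z]] by (intro mult_le_mono1) simp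
  then show ?thesis
    using z unfolding key_def by simp
qed

lemma best_less: "j \<le> m \<Longrightarrow> bestA j x < Suc m * n"
proof -
  assume j: "j \<le> m"
  have K: "0 < Suc m * n" using n_pos by simp
  have "best0 x \<le> Suc m * n - 1" for x
    by (rule scatter_max_le [OF best0]) (use key_less K in \<open>force simp: key_def\<close>)+
  moreover have "best (L i) \<le> Suc m * n - 1" if "i < j" for i
    using best_is_key [of "L i"] L_less [of i] key_less that j K by fastforce
  ultimately have "bestA j x \<le> Suc m * n - 1"
    by (rule scatter_max_le [OF scatter_best [OF j]])
  then show ?thesis using K by linarith
qed

lemma need_le: "j \<le> m \<Longrightarrow> needA j x \<le> 2 * m"
proof (induction j arbitrary: x)
  case 0
  have "need0 x \<le> m"
    by (rule scatter_max_le [OF need0]) auto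
  then show ?case by simp
next
  case (Suc j)
  have "bestA j (L j) < Suc m * n"
    using best_less Suc.prems by simp
  then have "bestA j (L j) div n \<le> m"
    using less_mult_imp_div_less by (metis less_Suc_eq_le)
  then show ?case
    using Suc.IH Suc.prems by (auto simp: Let_def split_beta)
qed

end

section \<open>Blocks and counted loops on the word RAM\<close>

type_synonym store = "(reg \<Rightarrow> nat) \<times> (nat \<Rightarrow> nat)"

fun straight :: "instr \<Rightarrow> bool" where
  "straight (Jump l) = False"
| "straight (JumpIf a l) = False"
| "straight _ = True"

fun exec_straight :: "nat \<Rightarrow> instr \<Rightarrow> store \<Rightarrow> store" where
  "exec_straight w (Const d c) (R, M) = (R(d := c mod 2 ^ w), M)"
| "exec_straight w (Copy d a) (R, M) = (R(d := R a), M)"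
| "exec_straight w (Arith f d a a') (R, M) = (R(d := eval_binop w f (R a) (R a')), M)"
| "exec_straight w (Load d a) (R, M) = (R(d := M (R a)), M)"
| "exec_straight w (Store a d) (R, M) = (R, M(R a := R d))"
| "exec_straight w _ s = s"

definition run :: "nat \<Rightarrow> instr list \<Rightarrow> store \<Rightarrow> store" where
  "run w is s = fold (exec_straight w) is s"

lemma run_Nil [simp]: "run w [] s = s"
  and run_Cons: "run w (i # is) s = run w is (exec_straight w i s)"
  and run_append: "run w (is @ is') s = run w is' (run w is s)"
  by (simp_all add: run_def)

fun config_of :: "nat \<Rightarrow> store \<Rightarrow> config" where
  "config_of l (R, M) = \<lparr>pc = l, regs = R, mem = M\<rparr>"

definition code_at :: "program \<Rightarrow> nat \<Rightarrow> instr list \<Rightarrow> bool" where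
  "code_at P l is \<longleftrightarrow> (\<forall>i < length is. l + i < length P \<and> P ! (l + i) = is ! i)"

lemma code_at_append:
  "code_at P l (is @ is') \<longleftrightarrow> code_at P l is \<and> code_at P (l + length is) is'"
proof -
  have "(\<forall>i < length is + k. Q i) \<longleftrightarrow> (\<forall>i < length is. Q i) \<and> (\<forall>i < k. Q (length is + i))" for Q k
  proof (intro iffI conjI allI impI)
    fix i assume "(\<forall>i < length is. Q i) \<and> (\<forall>i < k. Q (length is + i))" "i < length is + k"
    then show "Q i"
      by (cases "i < length is") (auto dest: spec [of _ "i - length is"])
  qed auto
  then show ?thesis
    unfolding code_at_def by (simp add: nth_append add.assoc)
qed

lemma code_at_Cons:
  "code_at P l (i # is) \<longleftrightarrow> l < length P \<and> P ! l = i \<and> code_at P (Suc l) is"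
  using code_at_append [of P l "[i]" "is"] by (simp add: code_at_def)

lemma code_at_self: "code_at P 0 P"
  by (simp add: code_at_def)

lemma step_straight:
  assumes "l < length P" "straight (P ! l)"
  shows "step w P (config_of l s) = config_of (Suc l) (exec_straight w (P ! l) s)"
  using assms by (cases s; cases "P ! l") (simp_all add: step_def halted_def)

lemma steps_straight:
  assumes "code_at P l is" "list_all straight is"
  shows "(step w P ^^ length is) (config_of l s) = config_of (l + length is) (run w is s)"
  using assms
proof (induction "is" arbitrary: l s)
  case (Cons i "is")
  then have "step w P (config_of l s) = config_of (Suc l) (exec_straight w i s)"
    using step_straight [of l P w s] by (simp add: code_at_Cons)
  moreover have "(step w P ^^ length is) (config_of (Suc l) (exec_straight w i s)) =
      config_of (Suc l + length is) (run w is (exec_straight w i s))"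
    using Cons by (simp add: code_at_Cons)
  ultimately show ?case
    by (simp add: funpow_swap1 run_Cons)
qed simp

datatype segment = Block "instr list" | Loop reg "instr list"

fun segment_code :: "nat \<Rightarrow> segment \<Rightarrow> instr list" where
  "segment_code l (Block is) = is"
| "segment_code l (Loop c is) = is @ [JumpIf c l]"

fun segment_length :: "segment \<Rightarrow> nat" where
  "segment_length (Block is) = length is"
| "segment_length (Loop c is) = Suc (length is)"

fun assemble :: "nat \<Rightarrow> segment list \<Rightarrow> program" where
  "assemble l [] = []"
| "assemble l (s # ss) = segment_code l s @ assemble (l + segment_length s) ss"

lemma length_segment_code [simp]: "length (segment_code l s) = segment_length s"
  by (cases s) simp_all

lemma length_assemble [simp]: "length (assemble l ss) = sum_list (map segment_length ss)"
  by (induction ss arbitrary: l) simp_all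

text \<open>Quantifying over \<open>P\<close> and \<open>l\<close> makes a segment independent of
  its surroundings and its absolute position, so runs compose. The number \<open>k\<close> of steps
  is exact.\<close>

definition runs :: "nat \<Rightarrow> segment list \<Rightarrow> store \<Rightarrow> nat \<Rightarrow> store \<Rightarrow> bool" where
  "runs w ss s k s' \<longleftrightarrow>
     (\<forall>P l. code_at P l (assemble l ss) \<longrightarrow>
        (step w P ^^ k) (config_of l s) = config_of (l + length (assemble l ss)) s')"

lemma runs_Cons:
  assumes "runs w [x] s k s'" "runs w ss s' k' s''"
  shows "runs w (x # ss) s (k + k') s''"
  unfolding runs_def
proof (intro allI impI)
  fix P l assume c: "code_at P l (assemble l (x # ss))"
  have "(step w P ^^ (k + k')) (config_of l s) = (step w P ^^ k') ((step w P ^^ k) (config_of l s))"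
    by (metis add.commute comp_apply funpow_add)
  also have "(step w P ^^ k) (config_of l s) = config_of (l + segment_length x) s'"
    using assms(1) c unfolding runs_def by (auto simp: code_at_append)
  also have "(step w P ^^ k') \<dots> = config_of (l + length (assemble l (x # ss))) s''"
    using assms(2) c unfolding runs_def by (auto simp: code_at_append add.assoc)
  finally show "(step w P ^^ (k + k')) (config_of l s) = config_of (l + length (assemble l (x # ss))) s''" .
qed

lemma runs_Block: "list_all straight is \<Longrightarrow> runs w [Block is] s (length is) (run w is s)"
  unfolding runs_def using steps_straight by simp

text \<open>The test follows the body, so at least one pass is made; this is why
  \<open>0 < N\<close> is required. The jump adds one step per pass.\<close>

lemma runs_Loop:
  assumes "list_all straight is" "0 < N" "Inv 0 s"
    and body: "\<And>i s. i < N \<Longrightarrow> Inv i s \<Longrightarrow>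
      Inv (Suc i) (run w is s) \<and> (fst (run w is s) c \<noteq> 0 \<longleftrightarrow> Suc i < N)"
  shows "\<exists>s'. Inv N s' \<and> runs w [Loop c is] s (N * Suc (length is)) s'"
proof -
  define it where "it i = (run w is ^^ i) s" for i
  have it_Suc: "it (Suc i) = run w is (it i)" for i
    by (simp add: it_def)
  have inv: "Inv i (it i)" if "i \<le> N" for i
    using that
  proof (induction i)
    case 0
    then show ?case using assms(3) by (simp add: it_def)
  next
    case (Suc i)
    then show ?case using body it_Suc by simp
  qed
  have "(step w P ^^ (N * Suc (length is))) (config_of l s) = config_of (l + Suc (length is)) (it N)"
    if code: "code_at P l (is @ [JumpIf c l])" for P l
  proof -
    have one: "(step w P ^^ Suc (length is)) (config_of l (it i)) =
        config_of (if Suc i < N then l else l + Suc (length is)) (it (Suc i))" if "i < N" for i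
    proof -
      have "(step w P ^^ length is) (config_of l (it i)) = config_of (l + length is) (it (Suc i))"
        using steps_straight [OF _ assms(1)] code it_Suc by (simp add: code_at_append)
      moreover have "P ! (l + length is) = JumpIf c l" "l + length is < length P"
        using code by (auto simp: code_at_append code_at_Cons)
      moreover have "fst (it (Suc i)) c \<noteq> 0 \<longleftrightarrow> Suc i < N"
        using body [OF that] inv [of i] that it_Suc by simp
      ultimately show ?thesis
        by (cases "it (Suc i)") (auto simp: step_def halted_def)
    qed
    have "i \<le> N \<Longrightarrow> (step w P ^^ (i * Suc (length is))) (config_of l s) =
        config_of (if i < N then l else l + Suc (length is)) (it i)" for i
    proof (induction i)
      case 0
      then show ?case using assms(2) by (simp add: it_def)
    next
      case (Suc i)
      have "(step w P ^^ (Suc i * Suc (length is))) (config_of l s) =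
          (step w P ^^ Suc (length is)) ((step w P ^^ (i * Suc (length is))) (config_of l s))"
        by (metis comp_apply funpow_add mult_Suc)
      also have "\<dots> = (step w P ^^ Suc (length is)) (config_of l (it i))"
        using Suc by simp
      finally show ?case
        using one [of i] Suc.prems by simp
    qed
    from this [of N] show ?thesis by simp
  qed
  then have "runs w [Loop c is] s (N * Suc (length is)) (it N)"
    unfolding runs_def by simp
  with inv [of N] show ?thesis by blast
qed

section \<open>The program\<close>

text \<open>
  Behind the input, whose length is \<open>B\<close>, memory holds eight interleaved arrays, cell \<open>i\<close> of array
  \<open>k\<close> being at address \<open>B + 8 * i + k\<close>. Array 2 holds the numbers of unnumbered children, 3 the
  nodes in bottom-up order, 4 the position of a node in this order, 5 and 6 the two tables of the
  dynamic program, and 7 marks the selected vertices.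
\<close>

definition memory :: "nat \<Rightarrow> (nat \<Rightarrow> nat) \<Rightarrow> (nat \<Rightarrow> nat \<Rightarrow> nat) \<Rightarrow> nat \<Rightarrow> nat" where
  "memory B I A a = (if a < B then I a else A ((a - B) mod 8) ((a - B) div 8))"

lemma memory_input: "a < B \<Longrightarrow> memory B I A a = I a"
  by (simp add: memory_def)

lemma memory_upd_input: "a < B \<Longrightarrow> (memory B I A)(a := v) = memory B (I(a := v)) A"
  by (rule ext) (simp add: memory_def)

lemma memory_array: "k < 8 \<Longrightarrow> memory B I A (i * 8 + (B + k)) = A k i"
  by (simp add: memory_def)

lemma memory_upd_array:
  assumes "k < 8"
  shows "(memory B I A)(i * 8 + (B + k) := v) = memory B I (A(k := (A k)(i := v)))"
proof
  fix a
  show "((memory B I A)(i * 8 + (B + k) := v)) a = memory B I (A(k := (A k)(i := v))) a"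
  proof (cases "a = i * 8 + (B + k)")
    case True
    then show ?thesis using assms by (simp add: memory_def)
  next
    case False
    have "(a - B) mod 8 \<noteq> k \<or> (a - B) div 8 \<noteq> i" if "\<not> a < B"
    proof (rule ccontr)
      assume "\<not> ?thesis"
      then have "a - B = i * 8 + k"
        using div_mult_mod_eq [of "a - B" 8] by metis
      with False that show False by linarith
    qed
    then show ?thesis using False by (simp add: memory_def)
  qed
qed

text \<open>
  Registers: 2 loop counter, 3 queue or output length, 4 loop condition, 5--13 scratch, 14--16
  scratch of the macros, 20 \<open>n\<close>, 21 \<open>m\<close>, 22 one, 23 eight, \<open>22 + k\<close> the base of array \<open>k\<close>, 30 zero,
  31--33 the bases of the parents, top nodes and bottom nodes in the input.
\<close>

definition get :: "reg \<Rightarrow> nat \<Rightarrow> reg \<Rightarrow> instr list" where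
  "get d k i = [Arith Mul 14 i 23, Arith Add 14 14 (22 + k), Load d 14]"

definition put :: "nat \<Rightarrow> reg \<Rightarrow> reg \<Rightarrow> instr list" where
  "put k i a = [Arith Mul 14 i 23, Arith Add 14 14 (22 + k), Store 14 a]"

definition get_input :: "reg \<Rightarrow> reg \<Rightarrow> reg \<Rightarrow> instr list" where
  "get_input d base i = [Arith Add 14 base i, Load d 14]"

definition set_if :: "reg \<Rightarrow> reg \<Rightarrow> reg \<Rightarrow> instr list" where
  "set_if d c a = [Arith Sub 16 a d, Arith Mul 16 16 c, Arith Add d d 16]"

definition set_max :: "reg \<Rightarrow> reg \<Rightarrow> instr list" where
  "set_max d a = Arith Less 15 d a # set_if d 15 a"

definition next_below :: "reg \<Rightarrow> instr list" where
  "next_below N = [Arith Add 2 2 22, Arith Less 4 2 N]"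

definition setup_code :: "instr list" where
  "setup_code =
     [Const 30 0, Const 22 1, Load 20 30, Load 21 22, Const 23 8, Const 31 2,
      Arith Add 32 31 21, Arith Add 33 32 20, Arith Add 24 33 20, Arith Add 24 24 31,
      Arith Add 25 24 22, Arith Add 26 25 22, Arith Add 27 26 22, Arith Add 28 27 22,
      Arith Add 29 28 22, Const 2 0]"

definition count_code :: "instr list" where
  "count_code = get_input 5 31 2 @ [Arith Equal 6 5 2, Arith Less 6 6 22] @
     get 7 2 5 @ [Arith Add 7 7 6] @ put 2 5 7 @ next_below 21"

definition leaf_code :: "instr list" where
  "leaf_code = put 3 3 2 @ get 5 2 2 @ [Arith Equal 5 5 30, Arith Add 3 3 5] @ next_below 21"

definition peel_code :: "instr list" where
  "peel_code = get 5 3 2 @ put 4 5 2 @ get_input 6 31 5 @ [Arith Equal 7 6 5, Arith Less 7 7 22] @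
     get 8 2 6 @ [Arith Sub 8 8 7] @ put 2 6 8 @ put 3 3 6 @
     [Arith Equal 8 8 30, Arith Mul 8 8 7, Arith Add 3 3 8] @ next_below 21"

definition path_code :: "instr list" where
  "path_code = get_input 5 33 2 @ get_input 6 32 2 @ get 6 4 6 @
     [Arith Add 7 6 22, Arith Mul 7 7 20, Arith Add 7 7 2, Arith Sub 8 21 6] @
     get 9 5 5 @ set_max 9 7 @ put 5 5 9 @ get 9 6 5 @ set_max 9 8 @ put 6 5 9 @ next_below 20"

definition dp_read_code :: "instr list" where
  "dp_read_code = get 5 3 2 @ get_input 6 31 5 @ get 7 5 5 @ get 8 6 5 @
     [Arith Sub 9 21 2, Arith Equal 9 8 9, Arith Mod 10 7 20] @
     get 11 7 10 @ [Arith Or 11 11 9] @ put 7 10 11"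

definition dp_select_code :: "instr list" where
  "dp_select_code = [Arith Div 10 7 20, Arith Add 10 21 10] @ set_if 8 9 10 @
     [Arith Add 10 21 22, Arith Add 10 10 2, Arith Equal 10 8 10] @ set_if 8 10 30"

definition dp_push_code :: "instr list" where
  "dp_push_code = get 9 5 6 @ set_max 9 7 @ put 5 6 9 @ get 9 6 6 @ set_max 9 8 @ put 6 6 9 @
     next_below 21"

definition dp_code :: "instr list" where
  "dp_code = dp_read_code @ dp_select_code @ dp_push_code"

definition output_code :: "instr list" where
  "output_code = get 5 7 2 @ [Arith Add 6 3 22, Store 6 2, Arith Add 3 3 5] @ next_below 20"

definition domination_segments :: "segment list" where
  "domination_segments =
     [Block setup_code, Loop 4 count_code, Block [Const 2 0, Const 3 0], Loop 4 leaf_code,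
      Block [Const 2 0], Loop 4 peel_code, Block [Const 2 0], Loop 4 path_code,
      Block [Const 2 0], Loop 4 dp_code, Block [Const 2 0, Const 3 0], Loop 4 output_code,
      Block [Store 30 3]]"

section \<open>Branch-free conditional updates\<close>

definition scaled_diff :: "nat \<Rightarrow> nat \<Rightarrow> nat \<Rightarrow> bool \<Rightarrow> nat" where
  "scaled_diff w x y c = ((y + 2 ^ w - x) mod 2 ^ w * of_bool c) mod 2 ^ w"

text \<open>This is \<open>x + c * (y - x)\<close> modulo \<open>2 ^ w\<close>: if
  \<open>y < x\<close> the difference wraps around, and the addition of \<open>x\<close> cancels the
  wrap.\<close>

lemma add_scaled_diff:
  assumes "x < 2 ^ w" "y < 2 ^ w"
  shows "(x + scaled_diff w x y c) mod 2 ^ w = (if c then y else x)"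
proof (cases c)
  case True
  have "x + (y + 2 ^ w - x) = y + 2 ^ w"
    using assms by simp
  then show ?thesis
    using True assms by (simp add: scaled_diff_def mod_add_right_eq)
qed (use assms in \<open>simp add: scaled_diff_def\<close>)

lemma run_set_if:
  assumes "R c = of_bool P" "R d < 2 ^ w" "R a < 2 ^ w" "c \<noteq> 16" "d \<noteq> 16" "a \<noteq> 16"
  shows "run w (set_if d c a) (R, M) =
    (R(16 := scaled_diff w (R d) (R a) P, d := if P then R a else R d), M)"
  using add_scaled_diff [OF assms(2,3), of P] assms
  by (simp add: set_if_def run_Cons scaled_diff_def)

lemma run_set_max:
  assumes "R d < 2 ^ w" "R a < 2 ^ w" "d \<noteq> 16" "a \<noteq> 16" "d \<noteq> 15" "a \<noteq> 15"
  shows "run w (set_max d a) (R, M) =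
    (R(15 := of_bool (R d < R a), 16 := scaled_diff w (R d) (R a) (R d < R a), d := max (R d) (R a)), M)"
  using assms by (simp add: set_max_def run_Cons run_set_if [where P = "R d < R a"] max_def)

lemma sub_mod_word:
  fixes x y :: nat
  assumes "y \<le> x" "x < 2 ^ w"
  shows "(x + 2 ^ w - y) mod 2 ^ w = x - y"
proof -
  have "x + 2 ^ w - y = (x - y) + 2 ^ w"
    using assms by simp
  moreover have "x - y < 2 ^ w"
    using assms by linarith
  ultimately show ?thesis
    by (metis mod_add_self2 mod_less)
qed

lemma of_bool_less_one: "of_bool P < (1::nat) \<longleftrightarrow> \<not> P"
  by (cases P) simp_all

section \<open>Effect of a single pass through each loop body\<close>

locale machine =
  fixes w n m B :: nat and p t b :: "nat \<Rightarrow> nat" and I :: "nat \<Rightarrow> nat"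
  assumes n_pos: "0 < n" and m_pos: "0 < m"
    and B: "B = 2 + m + 2 * n"
    and wide: "16 * (n + m + 2)\<^sup>2 \<le> 2 ^ w"
    and I_parent: "\<And>x. x < m \<Longrightarrow> I (2 + x) = p x"
    and I_top: "\<And>z. z < n \<Longrightarrow> I (2 + m + z) = t z"
    and I_bot: "\<And>z. z < n \<Longrightarrow> I (2 + m + n + z) = b z"
begin

text \<open>Since \<open>s\<close> is at least 4, the quadratic bound contains a linear one with
  room for all addresses: indices up to \<open>m + n\<close> lead to addresses of at most
  \<open>9 * m + 10 * n + 9\<close>.\<close>

lemma wide_linear: "16 * m + 24 * n + 116 \<le> 2 ^ w"
proof -
  define s where "s = n + m + 2"
  have "4 * s \<le> s\<^sup>2"
    unfolding power2_eq_square s_def using n_pos m_pos by (intro mult_le_mono1) simp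
  then show ?thesis
    using wide n_pos m_pos unfolding s_def [symmetric] by (simp add: s_def)
qed

definition constants :: "(reg \<Rightarrow> nat) \<Rightarrow> bool" where
  "constants R \<longleftrightarrow> R 20 = n \<and> R 21 = m \<and> R 22 = 1 \<and> R 23 = 8 \<and> R 24 = B + 2 \<and> R 25 = B + 3 \<and>
     R 26 = B + 4 \<and> R 27 = B + 5 \<and> R 28 = B + 6 \<and> R 29 = B + 7 \<and> R 30 = 0 \<and>
     R 31 = 2 \<and> R 32 = 2 + m \<and> R 33 = 2 + m + n"

lemma address:
  assumes "i \<le> m + n" "k < 8"
  shows "i * 8 mod 2 ^ w = i * 8" "(i * 8 + (B + k)) mod 2 ^ w = i * 8 + (B + k)"
  using assms wide_linear B by simp_all

lemma run_get:
  assumes "R 23 = 8" "R (22 + k) = B + k" "k < 8" "R i \<le> m + n" 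
  shows "run w (get d k i) (R, memory B J A) = (R(14 := R i * 8 + (B + k), d := A k (R i)), memory B J A)"
  using address [OF assms(4,3)] assms by (simp add: get_def run_Cons memory_array)

lemma run_put:
  assumes "R 23 = 8" "R (22 + k) = B + k" "k < 8" "R i \<le> m + n" "a \<noteq> 14"
  shows "run w (put k i a) (R, memory B J A) =
    (R(14 := R i * 8 + (B + k)), memory B J (A(k := (A k)(R i := R a))))"
  using address [OF assms(4,3)] assms by (simp add: put_def run_Cons memory_upd_array)

lemma run_get_parent:
  assumes "R 31 = 2" "R i < m"
  shows "run w (get_input d 31 i) (R, memory B I A) = (R(14 := 2 + R i, d := p (R i)), memory B I A)"
  using assms wide_linear B I_parent [of "R i"] by (simp add: get_input_def run_Cons memory_input)

lemma run_get_top: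
  assumes "R 32 = 2 + m" "R i < n"
  shows "run w (get_input d 32 i) (R, memory B I A) = (R(14 := 2 + m + R i, d := t (R i)), memory B I A)"
  using assms wide_linear B I_top [of "R i"] by (simp add: get_input_def run_Cons memory_input)

lemma run_get_bot:
  assumes "R 33 = 2 + m + n" "R i < n"
  shows "run w (get_input d 33 i) (R, memory B I A) = (R(14 := 2 + m + n + R i, d := b (R i)), memory B I A)"
  using assms wide_linear B I_bot [of "R i"] by (simp add: get_input_def run_Cons memory_input)

lemmas exec_simps = run_append run_Cons run_get run_put run_get_parent run_get_top run_get_bot
  run_set_if run_set_max constants_def sub_mod_word of_bool_less_one

lemma product_less: "Suc m * n + 2 * m + n + 2 < 2 ^ w"
proof -
  have "Suc m * n + 2 * m + n + 2 \<le> (n + m + 2)\<^sup>2"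
    by (simp add: power2_eq_square algebra_simps)
  moreover have "0 < (n + m + 2)\<^sup>2" by simp
  ultimately show ?thesis using wide by linarith
qed

lemma w_pos: "0 < w"
  using wide_linear by (cases w) simp_all

lemma count_step:
  assumes "constants R" "R 2 = j" "j < m" "p j < m" "A 2 (p j) < m"
  shows "\<exists>R'. run w count_code (R, memory B I A) =
      (R', memory B I (A(2 := (A 2)(p j := A 2 (p j) + of_bool (p j \<noteq> j))))) \<and>
    constants R' \<and> R' 2 = Suc j \<and> R' 4 = of_bool (Suc j < m)"
  using assms wide_linear
  by (cases "p j = j") (simp_all add: count_code_def next_below_def exec_simps)

lemma leaf_step:
  assumes "constants R" "R 2 = j" "R 3 = q" "j < m" "q \<le> m"
  shows "\<exists>R'. run w leaf_code (R, memory B I A) = (R', memory B I (A(3 := (A 3)(q := j)))) \<and>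
    constants R' \<and> R' 2 = Suc j \<and> R' 3 = q + of_bool (A 2 j = 0) \<and> R' 4 = of_bool (Suc j < m)"
  using assms wide_linear
  by (cases "A 2 j = 0") (simp_all add: leaf_code_def next_below_def exec_simps)

lemma peel_step:
  assumes "constants R" "R 2 = j" "R 3 = q" "j < m" "q \<le> m"
    and "A 3 j = x" "x < m" "p x = y" "y < m" "A 2 y \<le> m" "y \<noteq> x \<Longrightarrow> 0 < A 2 y"
    and "d = A 2 y - of_bool (y \<noteq> x)"
  shows "\<exists>R'. run w peel_code (R, memory B I A) =
      (R', memory B I (A(4 := (A 4)(x := j), 2 := (A 2)(y := d), 3 := (A 3)(q := y)))) \<and>
    constants R' \<and> R' 2 = Suc j \<and> R' 3 = q + of_bool (d = 0 \<and> y \<noteq> x) \<and> R' 4 = of_bool (Suc j < m)"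
  using assms wide_linear w_pos
  by (cases "y = x"; cases "d = 0") (simp_all add: peel_code_def next_below_def exec_simps)

lemma path_step:
  assumes "constants R" "R 2 = j" "j < n" "b j = x" "x < m" "t j < m" "A 4 (t j) = i" "i < m"
    and "A 5 x < 2 ^ w" "A 6 x < 2 ^ w"
  shows "\<exists>R'. run w path_code (R, memory B I A) =
      (R', memory B I (A(5 := (A 5)(x := max (A 5 x) (Suc i * n + j)), 6 := (A 6)(x := max (A 6 x) (m - i))))) \<and>
    constants R' \<and> R' 2 = Suc j \<and> R' 4 = of_bool (Suc j < n)"
proof -
  have "Suc i * n \<le> m * n"
    using assms(8) by (intro mult_le_mono1) simp
  then have "n + i * n + j < 2 ^ w" "n + i * n < 2 ^ w"
    using product_less assms(3) by simp_all
  then show ?thesis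
    using assms wide_linear
    by (simp add: path_code_def next_below_def exec_simps)
qed

lemma dp_read_step:
  assumes "constants R" "R 2 = j" "j < m" "A 3 j = x" "x < m" "p x = y" "A 5 x = k" "A 6 x = v"
  shows "\<exists>R'. run w dp_read_code (R, memory B I A) =
      (R', memory B I (A(7 := (A 7)(k mod n := or (A 7 (k mod n)) (of_bool (v = m - j)))))) \<and>
    constants R' \<and> R' 2 = j \<and> R' 6 = y \<and> R' 7 = k \<and> R' 8 = v \<and> R' 9 = of_bool (v = m - j)"
proof -
  have "k mod n \<le> m + n"
    using n_pos mod_less_divisor [of n k] by linarith
  then show ?thesis
    using assms wide_linear by (simp add: dp_read_code_def exec_simps)
qed

lemma dp_select_step:
  assumes "constants R" "R 2 = j" "j < m" "R 7 = k" "k < Suc m * n" "R 8 = v" "v \<le> 2 * m"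
    and "R 9 = of_bool P" "v' = (if P then m + k div n else v)" "v'' = (if v' = m + 1 + j then 0 else v')"
  shows "\<exists>R'. run w dp_select_code (R, M) = (R', M) \<and>
    constants R' \<and> R' 2 = j \<and> R' 6 = R 6 \<and> R' 7 = k \<and> R' 8 = v''"
proof -
  have "k div n < Suc m"
    using assms(5) n_pos by (simp add: less_mult_imp_div_less)
  \<comment> \<open>Both alternatives are computed in every pass, so \<open>m + k div n\<close> must
    fit into a word even if \<open>P\<close> fails.\<close>
  then have "v' \<le> 2 * m" "m + k div n < 2 ^ w"
    using assms wide_linear by auto
  then show ?thesis
    using assms wide_linear
    by (simp add: dp_select_code_def exec_simps run_set_if [where P = P]
        run_set_if [where P = "v' = m + 1 + j"])
qed

lemma dp_push_step:
  assumes "constants R" "R 2 = j" "j < m" "R 6 = y" "y < m" "R 7 = k" "k < 2 ^ w" "R 8 = v" "v < 2 ^ w"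
    and "A 5 y < 2 ^ w" "A 6 y < 2 ^ w"
  shows "\<exists>R'. run w dp_push_code (R, memory B I A) =
      (R', memory B I (A(5 := (A 5)(y := max (A 5 y) k), 6 := (A 6)(y := max (A 6 y) v)))) \<and>
    constants R' \<and> R' 2 = Suc j \<and> R' 4 = of_bool (Suc j < m)"
  using assms wide_linear by (simp add: dp_push_code_def next_below_def exec_simps)

lemma dp_code_step:
  assumes "constants R" "R 2 = j" "j < m" "A 3 j = x" "x < m" "p x = y" "y < m"
    and k: "A 5 x = k" "k < Suc m * n" "A 5 y < Suc m * n"
    and need: "A 6 x \<le> 2 * m" "A 6 y \<le> 2 * m"
    and v: "v = (if A 6 x = m - j then m + k div n else A 6 x)" "v' = (if v = m + 1 + j then 0 else v)"
  shows "\<exists>R'. run w dp_code (R, memory B I A) =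
      (R', memory B I (A(7 := (A 7)(k mod n := or (A 7 (k mod n)) (of_bool (A 6 x = m - j))),
         5 := (A 5)(y := max (A 5 y) k), 6 := (A 6)(y := max (A 6 y) v')))) \<and>
    constants R' \<and> R' 2 = Suc j \<and> R' 4 = of_bool (Suc j < m)"
proof -
  let ?A = "A(7 := (A 7)(k mod n := or (A 7 (k mod n)) (of_bool (A 6 x = m - j))))"
  have "k div n < Suc m"
    using k(2) n_pos by (simp add: less_mult_imp_div_less)
  then have v': "v' < 2 ^ w"
    unfolding v using need(1) wide_linear by auto
  obtain R1 where R1: "run w dp_read_code (R, memory B I A) =
      (R1, memory B I (A(7 := (A 7)(k mod n := or (A 7 (k mod n)) (of_bool (A 6 x = m - j))))))"
    "constants R1" "R1 2 = j" "R1 6 = y" "R1 7 = k" "R1 8 = A 6 x" "R1 9 = of_bool (A 6 x = m - j)"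
    using dp_read_step [of R j A x y k "A 6 x"] assms by blast
  obtain R2 where R2: "run w dp_select_code (R1, memory B I ?A) = (R2, memory B I ?A)"
    "constants R2" "R2 2 = j" "R2 6 = y" "R2 7 = k" "R2 8 = v'"
    using dp_select_step [OF R1(2,3) assms(3) R1(5) k(2) R1(6) need(1) R1(7) v] R1(4) by metis
  show ?thesis
    using dp_push_step [OF R2(2,3) assms(3) R2(4) assms(7) R2(5) _ R2(6) v',
      of "A(7 := (A 7)(k mod n := or (A 7 (k mod n)) (of_bool (A 6 x = m - j))))"]
      k need product_less wide_linear
    unfolding dp_code_def run_append R1(1) R2(1) by simp
qed

text \<open>Each vertex is written tentatively behind the output so far, and the length advances
  only for a selected one. The output overwrites input cells, which this loop does not read, and
  \<open>Suc q < B\<close> keeps it away from the arrays.\<close>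

lemma output_step:
  assumes "constants R" "R 2 = j" "j < n" "R 3 = q" "q \<le> j"
  shows "\<exists>R'. run w output_code (R, memory B J A) = (R', memory B (J(Suc q := j)) A) \<and>
    constants R' \<and> R' 2 = Suc j \<and> R' 3 = (q + A 7 j) mod 2 ^ w \<and> R' 4 = of_bool (Suc j < n)"
proof -
  have "Suc q < B"
    using assms B by simp
  then show ?thesis
    using assms wide_linear
    by (simp add: output_code_def next_below_def exec_simps memory_upd_input)
qed

end

lemmas code_defs = count_code_def leaf_code_def peel_code_def path_code_def dp_code_def
  dp_read_code_def dp_select_code_def dp_push_code_def output_code_def setup_code_def
  get_def put_def get_input_def set_max_def set_if_def next_below_def

lemma straight_codes:
  "list_all straight setup_code" "list_all straight count_code" "list_all straight leaf_code"
  "list_all straight peel_code" "list_all straight path_code" "list_all straight dp_code"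
  "list_all straight output_code"
  by (simp_all add: code_defs)

definition domination_program :: program where
  "domination_program = assemble 0 domination_segments"

section \<open>Correctness of the program\<close>

locale domination_input = machine w n m B p t b I + parent_array p m r
  for w n m B :: nat and p t b I :: "nat \<Rightarrow> nat" and r :: nat +
  assumes I_n: "I 0 = n" and I_m: "I 1 = m"
    and top_less: "z < n \<Longrightarrow> t z < m" and bot_less: "z < n \<Longrightarrow> b z < m"
    and bot_below_top: "z < n \<Longrightarrow> below p (b z) (t z)"
begin

lemma constants_upd: "constants (R(2 := v)) = constants R" "constants (R(3 := v)) = constants R"
  by (simp_all add: constants_def)

lemma setup_run:
  "\<exists>R. run w setup_code (\<lambda>_. 0, memory B I A) = (R, memory B I A) \<and> constants R \<and> R 2 = 0"
proof -
  have "Suc (Suc (m + n + n)) = B" "B + 7 < 2 ^ w" "1 < B"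
    using B wide_linear by simp_all
  then show ?thesis
    using I_n I_m wide_linear w_pos
    by (simp add: setup_code_def run_Cons memory_input constants_def)
qed

text \<open>Arrays 5 to 7 are carried along as zero because the later maxima and marks start from
  fresh memory.\<close>

definition counted :: "nat \<Rightarrow> store \<Rightarrow> bool" where
  "counted j s \<longleftrightarrow> (\<exists>R A. s = (R, memory B I A) \<and> constants R \<and> R 2 = j \<and>
     (\<forall>x. A 2 x = card {c. c < j \<and> p c = x \<and> c \<noteq> x}) \<and> (\<forall>k\<in>{5,6,7}. A k = (\<lambda>_. 0)))"

lemma counted_step:
  assumes j: "j < m" and inv: "counted j s"
  shows "counted (Suc j) (run w count_code s) \<and> (fst (run w count_code s) 4 \<noteq> 0 \<longleftrightarrow> Suc j < m)"
proof -
  obtain R A where s: "s = (R, memory B I A)" "constants R" "R 2 = j"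
      "\<And>x. A 2 x = card {c. c < j \<and> p c = x \<and> c \<noteq> x}" "\<forall>k\<in>{5,6,7}. A k = (\<lambda>_. 0)"
    using inv unfolding counted_def by blast
  have "card {c. c < j \<and> p c = p j \<and> c \<noteq> p j} \<le> card {..<j}"
    by (rule card_mono) auto
  then have "A 2 (p j) < m"
    using s(4) j by simp
  then obtain R' where R': "run w count_code s =
      (R', memory B I (A(2 := (A 2)(p j := A 2 (p j) + of_bool (p j \<noteq> j)))))"
      "constants R'" "R' 2 = Suc j" "R' 4 = of_bool (Suc j < m)"
    using count_step [OF s(2,3) j parent_less [OF j]] s(1) by blast
  have "{c. c < Suc j \<and> p c = x \<and> c \<noteq> x} =
      {c. c < j \<and> p c = x \<and> c \<noteq> x} \<union> (if x = p j \<and> p j \<noteq> j then {j} else {})" for x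
    by (auto simp: less_Suc_eq)
  then have "card {c. c < Suc j \<and> p c = x \<and> c \<noteq> x} = A 2 x + of_bool (x = p j \<and> p j \<noteq> j)" for x
    using s(4) by auto
  then show ?thesis
    unfolding counted_def R'(1) using R' s(5) by auto
qed

definition enqueued :: "(nat \<Rightarrow> nat) \<Rightarrow> nat \<Rightarrow> store \<Rightarrow> bool" where
  "enqueued deg j s \<longleftrightarrow> (\<exists>R A q. s = (R, memory B I A) \<and> constants R \<and> R 2 = j \<and> R 3 = q \<and>
     A 2 = deg \<and> q \<le> j \<and> inj_on (A 3) {..<q} \<and> A 3 ` {..<q} = {x. x < j \<and> deg x = 0} \<and>
     (\<forall>k\<in>{5,6,7}. A k = (\<lambda>_. 0)))"

lemma enqueued_step:
  assumes j: "j < m" and inv: "enqueued deg j s"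
  shows "enqueued deg (Suc j) (run w leaf_code s) \<and> (fst (run w leaf_code s) 4 \<noteq> 0 \<longleftrightarrow> Suc j < m)"
proof -
  obtain R A q where s: "s = (R, memory B I A)" "constants R" "R 2 = j" "R 3 = q" "A 2 = deg" "q \<le> j"
      "inj_on (A 3) {..<q}" "A 3 ` {..<q} = {x. x < j \<and> deg x = 0}" "\<forall>k\<in>{5,6,7}. A k = (\<lambda>_. 0)"
    using inv unfolding enqueued_def by blast
  define L where "L = (A 3)(q := j)"
  obtain R' where R': "run w leaf_code s = (R', memory B I (A(3 := L)))"
      "constants R'" "R' 2 = Suc j" "R' 3 = q + of_bool (deg j = 0)" "R' 4 = of_bool (Suc j < m)"
    using leaf_step [OF s(2-4) j, of A] s(1,5,6) j unfolding L_def by auto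
  have img: "L ` {..<q} = {x. x < j \<and> deg x = 0}" and inj: "inj_on L {..<q}"
    using s(7,8) unfolding L_def by (auto simp: inj_on_def)
  have "L ` {..<q + of_bool (deg j = 0)} = {x. x < Suc j \<and> deg x = 0}"
    using img by (auto simp: lessThan_Suc L_def less_Suc_eq)
  moreover have "inj_on L {..<q + of_bool (deg j = 0)}"
    using img inj by (auto simp: lessThan_Suc L_def inj_on_insert)
  ultimately show ?thesis
    unfolding enqueued_def R'(1) using R' s(5,6,9)
    by (intro conjI exI [of _ R'] exI [of _ "A(3 := L)"] exI [of _ "R' 3"]) auto
qed

definition peeled :: "nat \<Rightarrow> store \<Rightarrow> bool" where
  "peeled j s \<longleftrightarrow> (\<exists>R A. s = (R, memory B I A) \<and> constants R \<and> R 2 = j \<and>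
     peeling p m j (R 3) (A 2) (A 3) (A 4) \<and> (\<forall>k\<in>{5,6,7}. A k = (\<lambda>_. 0)))"

lemma peeled_step:
  assumes j: "j < m" and inv: "peeled j s"
  shows "peeled (Suc j) (run w peel_code s) \<and> (fst (run w peel_code s) 4 \<noteq> 0 \<longleftrightarrow> Suc j < m)"
proof -
  obtain R A where s: "s = (R, memory B I A)" "constants R" "R 2 = j"
      "peeling p m j (R 3) (A 2) (A 3) (A 4)" "\<forall>k\<in>{5,6,7}. A k = (\<lambda>_. 0)"
    using inv unfolding peeled_def by blast
  define x y d where "x = A 3 j" and "y = p x" and "d = A 2 y - of_bool (y \<noteq> x)"
  have "j < R 3"
    using peeling_progress [OF s(4) j] .
  then have x: "x < m"
    using s(4) unfolding peeling_def x_def by auto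
  then have y: "y < m"
    unfolding y_def by (rule parent_less)
  have "A 2 y = card (children p m y - A 3 ` {..<j})"
    using s(4) y unfolding peeling_def by simp
  also have "\<dots> \<le> card {..<m}"
    unfolding children_def by (rule card_mono) auto
  finally have dy: "A 2 y \<le> m" by simp
  note step = peeling_step [OF s(4) j y_def [unfolded x_def] d_def [unfolded x_def]]
  obtain R' where R': "run w peel_code s =
      (R', memory B I (A(4 := (A 4)(x := j), 2 := (A 2)(y := d), 3 := (A 3)(R 3 := y))))"
      "constants R'" "R' 2 = Suc j" "R' 3 = R 3 + of_bool (d = 0 \<and> y \<noteq> x)" "R' 4 = of_bool (Suc j < m)"
    using peel_step [OF s(2,3) refl j peeling_queue_le [OF s(4)] x_def [symmetric] x y_def [symmetric] y dy _ d_def]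
      step(2) s(1) unfolding x_def by auto
  show ?thesis
    unfolding peeled_def R'(1) using R' s(5) step(1)
    by (intro conjI exI [of _ R']
        exI [of _ "A(4 := (A 4)(x := j), 2 := (A 2)(y := d), 3 := (A 3)(R 3 := y))"]) (auto simp: x_def)
qed

definition initialised :: "(nat \<Rightarrow> nat) \<Rightarrow> (nat \<Rightarrow> nat) \<Rightarrow> nat \<Rightarrow> store \<Rightarrow> bool" where
  "initialised L pos j s \<longleftrightarrow> (\<exists>R A. s = (R, memory B I A) \<and> constants R \<and> R 2 = j \<and>
     A 3 = L \<and> A 4 = pos \<and> scatter_max (\<lambda>_. 0) b (\<lambda>z. Suc (pos (t z)) * n + z) j (A 5) \<and>
     scatter_max (\<lambda>_. 0) b (\<lambda>z. m - pos (t z)) j (A 6) \<and> A 7 = (\<lambda>_. 0))"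

lemma initialised_step:
  assumes order: "bottom_up p m L pos" and j: "j < n" and inv: "initialised L pos j s"
  shows "initialised L pos (Suc j) (run w path_code s) \<and> (fst (run w path_code s) 4 \<noteq> 0 \<longleftrightarrow> Suc j < n)"
proof -
  obtain R A where s: "s = (R, memory B I A)" "constants R" "R 2 = j" "A 3 = L" "A 4 = pos"
      "scatter_max (\<lambda>_. 0) b (\<lambda>z. Suc (pos (t z)) * n + z) j (A 5)"
      "scatter_max (\<lambda>_. 0) b (\<lambda>z. m - pos (t z)) j (A 6)" "A 7 = (\<lambda>_. 0)"
    using inv unfolding initialised_def by blast
  have pos: "pos (t z) < m" if "z < n" for z
    using order top_less [OF that] unfolding bottom_up_def by simp
  have "Suc (pos (t z)) * n + z \<le> Suc m * n" if "z < j" for z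
  proof -
    have "Suc (pos (t z)) * n \<le> m * n"
      using pos [of z] that j by (intro mult_le_mono1) simp
    then show ?thesis using that j by simp
  qed
  then have "A 5 (b j) \<le> Suc m * n"
    by (rule scatter_max_le [OF s(6) le0])
  moreover have "A 6 (b j) \<le> m"
    by (rule scatter_max_le [OF s(7)]) auto
  ultimately have bounds: "A 5 (b j) < 2 ^ w" "A 6 (b j) < 2 ^ w"
    using product_less by linarith+
  obtain R' where R': "run w path_code s = (R', memory B I
      (A(5 := (A 5)(b j := max (A 5 (b j)) (Suc (pos (t j)) * n + j)),
         6 := (A 6)(b j := max (A 6 (b j)) (m - pos (t j))))))"
      "constants R'" "R' 2 = Suc j" "R' 4 = of_bool (Suc j < n)"
    using path_step [where A = A and i = "pos (t j)",
        OF s(2,3) j refl bot_less [OF j] top_less [OF j] _ pos [OF j] bounds] s(1,5) by auto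
  have 5: "scatter_max (\<lambda>_. 0) b (\<lambda>z. Suc (pos (t z)) * n + z) (Suc j)
      ((A 5)(b j := max (A 5 (b j)) (Suc (pos (t j)) * n + j)))"
    by (rule scatter_max_Suc [OF s(6) refl refl])
  have 6: "scatter_max (\<lambda>_. 0) b (\<lambda>z. m - pos (t z)) (Suc j)
      ((A 6)(b j := max (A 6 (b j)) (m - pos (t j))))"
    by (rule scatter_max_Suc [OF s(7) refl refl])
  show ?thesis
    unfolding initialised_def R'(1) using R' s 5 6
    by (intro conjI exI [of _ R']
        exI [of _ "A(5 := (A 5)(b j := max (A 5 (b j)) (Suc (pos (t j)) * n + j)),
          6 := (A 6)(b j := max (A 6 (b j)) (m - pos (t j))))"]) auto
qed

definition processed :: "(nat \<Rightarrow> nat) \<Rightarrow> (nat \<Rightarrow> nat) \<Rightarrow> (nat \<Rightarrow> nat) \<Rightarrow> nat \<Rightarrow> store \<Rightarrow> bool" where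
  "processed L best0 need0 j s \<longleftrightarrow> (\<exists>R A. s = (R, memory B I A) \<and> constants R \<and> R 2 = j \<and>
     A 3 = L \<and> dp p m n L best0 need0 j = (A 5, A 6, A 7))"

lemma processed_step:
  assumes dp: "dp_input p m r n t b L pos best0 need0"
    and j: "j < m" and inv: "processed L best0 need0 j s"
  shows "processed L best0 need0 (Suc j) (run w dp_code s) \<and> (fst (run w dp_code s) 4 \<noteq> 0 \<longleftrightarrow> Suc j < m)"
proof -
  interpret dp_input p m r n t b L pos best0 need0 by (rule dp)
  obtain R A where s: "s = (R, memory B I A)" "constants R" "R 2 = j" "A 3 = L"
      and state: "state j = (A 5, A 6, A 7)"
    using inv unfolding processed_def by blast
  define x y k v v' where "x = L j" and "y = p x" and "k = A 5 x"
    and "v = (if A 6 x = m - j then m + k div n else A 6 x)" and "v' = (if v = m + 1 + j then 0 else v)"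
  have x: "x < m" and y: "y < m"
    using L_less [OF j] parent_less unfolding x_def y_def by auto
  have bounds: "k < Suc m * n" "A 5 y < Suc m * n" "A 6 x \<le> 2 * m" "A 6 y \<le> 2 * m"
    using best_less [of j] need_le [of j] j unfolding k_def state by auto
  obtain R' where R': "run w dp_code s =
      (R', memory B I (A(7 := (A 7)(k mod n := or (A 7 (k mod n)) (of_bool (A 6 x = m - j))),
         5 := (A 5)(y := max (A 5 y) k), 6 := (A 6)(y := max (A 6 y) v'))))"
      "constants R'" "R' 2 = Suc j" "R' 4 = of_bool (Suc j < m)"
    using dp_code_step [OF s(2,3) j _ x y_def [symmetric] y k_def [symmetric] bounds v_def v'_def] s(1,4)
    unfolding x_def by auto
  have "state (Suc j) = ((A 5)(y := max (A 5 y) k), (A 6)(y := max (A 6 y) v'),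
      (A 7)(k mod n := or (A 7 (k mod n)) (of_bool (A 6 x = m - j))))"
    by (simp add: state Let_def x_def y_def k_def v_def v'_def)
  then show ?thesis
    unfolding processed_def R'(1) using R' s
    by (intro conjI exI [of _ R']
        exI [of _ "A(7 := (A 7)(k mod n := or (A 7 (k mod n)) (of_bool (A 6 x = m - j))),
          5 := (A 5)(y := max (A 5 y) k), 6 := (A 6)(y := max (A 6 y) v'))"]) auto
qed

definition written :: "(nat \<Rightarrow> nat) \<Rightarrow> nat \<Rightarrow> store \<Rightarrow> bool" where
  "written sel j s \<longleftrightarrow> (\<exists>R J A. s = (R, memory B J A) \<and> constants R \<and> R 2 = j \<and> A 7 = sel \<and>
     R 3 = length (filter (\<lambda>v. sel v = 1) [0..<j]) \<and>
     (\<forall>i < R 3. J (Suc i) = filter (\<lambda>v. sel v = 1) [0..<j] ! i))"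

lemma written_step:
  assumes sel: "\<And>v. sel v \<le> 1" and j: "j < n" and inv: "written sel j s"
  shows "written sel (Suc j) (run w output_code s) \<and> (fst (run w output_code s) 4 \<noteq> 0 \<longleftrightarrow> Suc j < n)"
proof -
  obtain R J A where s: "s = (R, memory B J A)" "constants R" "R 2 = j" "A 7 = sel"
      "R 3 = length (filter (\<lambda>v. sel v = 1) [0..<j])"
      "\<forall>i < R 3. J (Suc i) = filter (\<lambda>v. sel v = 1) [0..<j] ! i"
    using inv unfolding written_def by blast
  have le: "R 3 \<le> j"
    using length_filter_le [of "\<lambda>v. sel v = 1" "[0..<j]"] s(5) by simp
  obtain R' where R': "run w output_code s = (R', memory B (J(Suc (R 3) := j)) A)"
      "constants R'" "R' 2 = Suc j" "R' 3 = (R 3 + A 7 j) mod 2 ^ w" "R' 4 = of_bool (Suc j < n)"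
    using output_step [OF s(2,3) j refl le] s(1) by blast
  have "R 3 + sel j < 2 ^ w"
    using le j sel [of j] wide_linear by linarith
  then have 3: "R' 3 = R 3 + sel j"
    using R'(4) s(4) by simp
  have "sel j = 0 \<or> sel j = 1"
    using sel [of j] by linarith
  then have "R' 3 = length (filter (\<lambda>v. sel v = 1) [0..<Suc j]) \<and>
     (\<forall>i < R' 3. (J(Suc (R 3) := j)) (Suc i) = filter (\<lambda>v. sel v = 1) [0..<Suc j] ! i)"
    using 3 s(5,6) by (auto simp: nth_append less_Suc_eq)
  then show ?thesis
    unfolding written_def R'(1) using R'(2,3,5) s(4)
    by (intro conjI exI [of _ R']
        exI [of _ "J(Suc (R 3) := j)"] exI [of _ "A"]) auto
qed

text \<open>An exact count: the loop bodies contain no jumps, so the time depends on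
  \<open>n\<close> and \<open>m\<close> only.\<close>

definition run_time :: nat where
  "run_time = 16 + m * Suc (length count_code) + 2 + m * Suc (length leaf_code) + 1 +
     m * Suc (length peel_code) + 1 + n * Suc (length path_code) + 1 +
     m * Suc (length dp_code) + 2 + n * Suc (length output_code) + 1"

lemma length_setup_code: "length setup_code = 16"
  by (simp add: setup_code_def)

lemma run_Const_Block: "runs w [Block [Const 2 0]] (R, M) 1 (R(2 := 0), M)"
  using runs_Block [of "[Const 2 0]" w "(R, M)"] by (simp add: run_Cons)

lemma run_Const2_Block: "runs w [Block [Const 2 0, Const 3 0]] (R, M) 2 (R(2 := 0, 3 := 0), M)"
  using runs_Block [of "[Const 2 0, Const 3 0]" w "(R, M)"] by (simp add: run_Cons numeral_2_eq_2)

definition result :: "(nat \<Rightarrow> nat) \<Rightarrow> (nat \<Rightarrow> nat) \<Rightarrow> (nat \<Rightarrow> nat) \<Rightarrow> nat list" where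
  "result L best0 need0 = filter (\<lambda>v. snd (snd (dp p m n L best0 need0 m)) v = 1) [0..<n]"

lemma domination_runs:
  "\<exists>L pos best0 need0 R J A. dp_input p m r n t b L pos best0 need0 \<and>
     runs w domination_segments (\<lambda>_. 0, memory B I (\<lambda>_ _. 0)) run_time (R, memory B J A) \<and>
     J 0 = length (result L best0 need0) \<and>
     (\<forall>i < length (result L best0 need0). J (Suc i) = result L best0 need0 ! i)"
proof -
  let ?s0 = "(\<lambda>_. 0, memory B I (\<lambda>_ _. 0)) :: store"
  obtain R1 where R1: "run w setup_code ?s0 = (R1, memory B I (\<lambda>_ _. 0))" "constants R1" "R1 2 = 0"
    using setup_run by blast
  have 1: "runs w [Block setup_code] ?s0 16 (R1, memory B I (\<lambda>_ _. 0))"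
    using runs_Block [OF straight_codes(1), of w ?s0] unfolding R1(1) length_setup_code .
  have "counted 0 (R1, memory B I (\<lambda>_ _. 0))"
    unfolding counted_def using R1 by auto
  from runs_Loop [where Inv = counted, OF straight_codes(2) m_pos this counted_step]
  obtain s2 where s2: "counted m s2"
      "runs w [Loop 4 count_code] (R1, memory B I (\<lambda>_ _. 0)) (m * Suc (length count_code)) s2"
    by blast
  then obtain R2 A2 where A2: "s2 = (R2, memory B I A2)" "constants R2"
      "\<forall>x. A2 2 x = card (children p m x)" "\<forall>k\<in>{5,6,7}. A2 k = (\<lambda>_. 0)"
    unfolding counted_def children_def by blast
  note 3 = run_Const2_Block [of R2 "memory B I A2"]
  have "enqueued (A2 2) 0 (R2(2 := 0, 3 := 0), memory B I A2)"
    unfolding enqueued_def using A2 by (auto simp: constants_upd)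
  from runs_Loop [where Inv = "enqueued (A2 2)", OF straight_codes(3) m_pos this enqueued_step]
  obtain s4 where s4: "enqueued (A2 2) m s4" "runs w [Loop 4 leaf_code]
      (R2(2 := 0, 3 := 0), memory B I A2) (m * Suc (length leaf_code)) s4"
    by blast
  then obtain R4 A4 where A4: "s4 = (R4, memory B I A4)" "constants R4" "A4 2 = A2 2"
      "inj_on (A4 3) {..<R4 3}" "A4 3 ` {..<R4 3} = {x. x < m \<and> A2 2 x = 0}"
      "\<forall>k\<in>{5,6,7}. A4 k = (\<lambda>_. 0)"
    unfolding enqueued_def by blast
  note 5 = run_Const_Block [of R4 "memory B I A4"]
  have "peeling p m 0 (R4 3) (A4 2) (A4 3) (A4 4)"
    by (rule peeling_init) (use A2(3) A4 in auto)
  then have "peeled 0 (R4(2 := 0), memory B I A4)"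
    unfolding peeled_def using A4(2,6) by (auto simp: constants_upd)
  from runs_Loop [where Inv = peeled, OF straight_codes(4) m_pos this peeled_step]
  obtain s6 where s6: "peeled m s6"
      "runs w [Loop 4 peel_code] (R4(2 := 0), memory B I A4) (m * Suc (length peel_code)) s6"
    by blast
  then obtain R6 A6 where A6: "s6 = (R6, memory B I A6)" "constants R6"
      "peeling p m m (R6 3) (A6 2) (A6 3) (A6 4)" "\<forall>k\<in>{5,6,7}. A6 k = (\<lambda>_. 0)"
    unfolding peeled_def by blast
  define L pos where "L = A6 3" and "pos = A6 4"
  have order: "bottom_up p m L pos"
    unfolding L_def pos_def by (rule peeling_final [OF A6(3)])
  note 7 = run_Const_Block [of R6 "memory B I A6"]
  have "initialised L pos 0 (R6(2 := 0), memory B I A6)"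
    unfolding initialised_def L_def pos_def using A6 by (auto simp: constants_upd scatter_max_0)
  from runs_Loop [where Inv = "initialised L pos", OF straight_codes(5) n_pos this initialised_step [OF order]]
  obtain s8 where s8: "initialised L pos n s8"
      "runs w [Loop 4 path_code] (R6(2 := 0), memory B I A6) (n * Suc (length path_code)) s8"
    by blast
  then obtain R8 A8 where A8: "s8 = (R8, memory B I A8)" "constants R8" "A8 3 = L"
      "scatter_max (\<lambda>_. 0) b (\<lambda>z. Suc (pos (t z)) * n + z) n (A8 5)"
      "scatter_max (\<lambda>_. 0) b (\<lambda>z. m - pos (t z)) n (A8 6)" "A8 7 = (\<lambda>_. 0)"
    unfolding initialised_def by blast
  define best0 need0 where "best0 = A8 5" and "need0 = A8 6"
  have dp: "dp_input p m r n t b L pos best0 need0"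
    unfolding best0_def need0_def
    by unfold_locales (use n_pos top_less bot_less bot_below_top order A8 in auto)
  then interpret D: dp_input p m r n t b L pos best0 need0 .
  note 9 = run_Const_Block [of R8 "memory B I A8"]
  have "processed L best0 need0 0 (R8(2 := 0), memory B I A8)"
    unfolding processed_def best0_def need0_def using A8 by (auto simp: constants_upd)
  from runs_Loop [where Inv = "processed L best0 need0", OF straight_codes(6) m_pos this processed_step [OF dp]]
  obtain s10 where s10: "processed L best0 need0 m s10"
      "runs w [Loop 4 dp_code] (R8(2 := 0), memory B I A8) (m * Suc (length dp_code)) s10"
    by blast
  then obtain R10 A10 where A10: "s10 = (R10, memory B I A10)" "constants R10"
      "D.state m = (A10 5, A10 6, A10 7)"
    unfolding processed_def by blast
  have sel: "A10 7 v \<le> 1" for v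
    using D.selA_eq [of m v] A10(3) by simp
  note 11 = run_Const2_Block [of R10 "memory B I A10"]
  have "written (A10 7) 0 (R10(2 := 0, 3 := 0), memory B I A10)"
    unfolding written_def using A10(2)
    by (intro exI [of _ "R10(2 := 0, 3 := 0)"] exI [of _ I] exI [of _ A10]) (auto simp: constants_upd)
  from runs_Loop [where Inv = "written (A10 7)", OF straight_codes(7) n_pos this written_step [OF sel]]
  obtain s12 where s12: "written (A10 7) n s12" "runs w [Loop 4 output_code]
      (R10(2 := 0, 3 := 0), memory B I A10) (n * Suc (length output_code)) s12"
    by blast
  have res: "result L best0 need0 = filter (\<lambda>v. A10 7 v = 1) [0..<n]"
    unfolding result_def A10(3) by simp
  from s12 obtain R12 J A12 where A12: "s12 = (R12, memory B J A12)" "constants R12"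
      "R12 3 = length (result L best0 need0)" "\<forall>i < R12 3. J (Suc i) = result L best0 need0 ! i"
    unfolding written_def res by blast
  have "0 < B" using B by simp
  then have 13: "runs w [Block [Store 30 3]] (R12, memory B J A12) 1 (R12, memory B (J(0 := R12 3)) A12)"
    using runs_Block [of "[Store 30 3]" w "(R12, memory B J A12)"] A12(2)
    by (simp add: run_Cons constants_def memory_upd_input)
  note chain = runs_Cons [OF 1 runs_Cons [OF s2(2) [unfolded A2(1)] runs_Cons [OF 3
    runs_Cons [OF s4(2) [unfolded A4(1)] runs_Cons [OF 5 runs_Cons [OF s6(2) [unfolded A6(1)]
    runs_Cons [OF 7 runs_Cons [OF s8(2) [unfolded A8(1)] runs_Cons [OF 9
    runs_Cons [OF s10(2) [unfolded A10(1)] runs_Cons [OF 11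
    runs_Cons [OF s12(2) [unfolded A12(1)] 13]]]]]]]]]]]]
  have "runs w domination_segments ?s0 run_time (R12, memory B (J(0 := R12 3)) A12)"
    using chain unfolding domination_segments_def run_time_def by (simp only: add.assoc)
  moreover have "(J(0 := R12 3)) 0 = length (result L best0 need0)"
      "\<forall>i < length (result L best0 need0). (J(0 := R12 3)) (Suc i) = result L best0 need0 ! i"
    using A12(3,4) by auto
  ultimately show ?thesis
    using dp by blast
qed

lemma run_time_le: "run_time \<le> 100 * n + 200 * m + 100"
  unfolding run_time_def by (simp add: code_defs)

lemma domination_outputs:
  assumes init: "initial_config w xs = config_of 0 (\<lambda>_. 0, memory B I (\<lambda>_ _. 0))"
    and k: "run_time \<le> k" and V: "pverts G = {..<n}"
    and E: "\<And>z v. z < n \<Longrightarrow> v < n \<Longrightarrow> z \<noteq> v \<Longrightarrow>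
      (z, v) \<in> parcs G \<longleftrightarrow> vpath p (t z) (b z) \<inter> vpath p (t v) (b v) \<noteq> {}"
  shows "\<exists>ys. outputs_within w domination_program xs k ys \<and> distinct ys \<and> minimum_dominating_set G (set ys)"
proof -
  obtain L pos best0 need0 R J A where dp: "dp_input p m r n t b L pos best0 need0"
    and run: "runs w domination_segments (\<lambda>_. 0, memory B I (\<lambda>_ _. 0)) run_time (R, memory B J A)"
    and J: "J 0 = length (result L best0 need0)"
      "\<forall>i < length (result L best0 need0). J (Suc i) = result L best0 need0 ! i"
    using domination_runs by blast
  interpret D: dp_input p m r n t b L pos best0 need0 by (rule dp)
  let ?ys = "result L best0 need0"
  have "(step w domination_program ^^ run_time) (initial_config w xs) =
      config_of (length domination_program) (R, memory B J A)"
    using run code_at_self [of domination_program] unfolding runs_def init domination_program_def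
    by (metis add_0)
  moreover have "output_of (config_of l (R, memory B J A)) = ?ys" for l
  proof (rule nth_equalityI)
    have len: "length ?ys \<le> n"
      unfolding result_def by (metis diff_zero length_filter_le length_upt)
    then have "memory B J A i = J i" if "i \<le> length ?ys" for i
      using that B by (simp add: memory_input)
    then show "length (output_of (config_of l (R, memory B J A))) = length ?ys"
      "\<And>i. i < length (output_of (config_of l (R, memory B J A))) \<Longrightarrow>
        output_of (config_of l (R, memory B J A)) ! i = ?ys ! i"
      using J by (auto simp: output_of_def simp del: upt_Suc)
  qed
  ultimately have "outputs_within w domination_program xs k ?ys"
    unfolding outputs_within_def using k by (intro exI [of _ run_time]) (simp add: halted_def Let_def)
  moreover have "set ?ys = D.pick ` D.picked"
    using D.selected unfolding result_def by auto
  moreover have "minimum_dominating_set G (D.pick ` D.picked)"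
    by (rule D.minimum [OF V finite_lessThan E])
  ultimately show ?thesis
    unfolding result_def by (metis distinct_filter distinct_upt)
qed

end

theorem theorem2:
  shows "\<exists>P :: program. \<forall>C :: nat. \<exists>\<kappa> :: real. \<exists>f :: nat \<Rightarrow> nat.
    \<kappa> > 0 \<and>
    (\<lambda>n. real (f n)) \<in> O(\<lambda>n. real n * ln (real n)) \<and>
    (\<forall>w :: nat \<Rightarrow> nat.
       (\<lambda>n. real (w n)) \<in> \<Theta>(\<lambda>n. ln (real n)) \<and> (\<forall>n. \<kappa> * log 2 (real n + 2) \<le> real (w n)) \<longrightarrow>
       (\<forall>(n :: nat) (G :: nat pair_pre_digraph) (T :: nat rooted_tree) t b.
          pair_graph G \<and> pverts G = {..<n} \<and> nodes T = {..<card (nodes T)} \<and>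
          card (nodes T) \<le> C * n \<and> rdv_representation G T t b \<longrightarrow>
          (\<exists>ys. outputs_within (w n) P (encode_rdv n (card (nodes T)) T t b) (f n) ys \<and>
                distinct ys \<and> minimum_dominating_set G (set ys))))"
proof (rule exI [of _ domination_program], rule allI)
  fix C :: nat
  \<comment> \<open>The bound of \<open>run_time_le\<close> with \<open>m \<le> C * n\<close>
    inserted.\<close>
  define f where "f n = (100 + 200 * C) * n + 100" for n :: nat
  \<comment> \<open>Since \<open>n + m + 2\<close> is at most \<open>(C + 1) * (n + 2)\<close>, the
    requirement \<open>wide\<close> follows from \<open>K * (n + 2)^2 <= 2^w\<close>. The 2 in
    \<open>\<kappa>\<close> pays for the square; \<open>log 2 K\<close> pays for the factor
    \<open>K\<close>, because \<open>log 2 (n + 2)\<close> is at least 1.\<close>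
  define K where "K = 16 * (real C + 1)\<^sup>2"
  define \<kappa> where "\<kappa> = 2 + log 2 K"
  have "1 \<le> (real C + 1)\<^sup>2" by simp
  then have K: "16 \<le> K" unfolding K_def by linarith
  then have \<kappa>: "2 \<le> \<kappa>"
    unfolding \<kappa>_def by simp
  have f: "(\<lambda>n. real (f n)) \<in> O(\<lambda>n. real n * ln (real n))"
  \<comment> \<open>From 3 on, \<open>ln n\<close> is at least 1, so a linear function lies below a
    multiple of \<open>n * ln n\<close>.\<close>
  proof (rule bigoI [of _ "200 + 200 * real C"], rule eventually_mono [OF eventually_ge_at_top [of 3]])
    fix n :: nat assume n: "3 \<le> n"
    have "exp 1 \<le> real n"
      using exp_le n by linarith
    then have "1 \<le> ln (real n)"
      using n by (subst ln_ge_iff) auto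
    then have "real n * 1 \<le> real n * ln (real n)"
      by (intro mult_left_mono) auto
    moreover have "real (f n) \<le> (200 + 200 * real C) * real n"
      using n unfolding f_def by (simp add: algebra_simps)
    moreover have "(200 + 200 * real C) * real n \<le> (200 + 200 * real C) * (real n * ln (real n))"
      using calculation(1) by (intro mult_left_mono) auto
    ultimately have "real (f n) \<le> (200 + 200 * real C) * (real n * ln (real n))"
      by linarith
    then show "norm (real (f n)) \<le> (200 + 200 * real C) * norm (real n * ln (real n))"
      using \<open>1 \<le> ln (real n)\<close> by simp
  qed
  have main: "\<exists>ys. outputs_within w domination_program (encode_rdv n (card (nodes T)) T t b) (f n) ys \<and>
                distinct ys \<and> minimum_dominating_set G (set ys)"
    if word: "\<kappa> * log 2 (real n + 2) \<le> real w"
      and G: "pverts G = {..<n}" "nodes T = {..<card (nodes T)}" "card (nodes T) \<le> C * n"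
      and rep: "rdv_representation G T t b"
    for n w G and T :: "nat rooted_tree" and t b
  proof -
    define m where "m = card (nodes T)"
    define p where "p = parent T"
    define B where "B = 2 + m + 2 * n"
    define xs where "xs = encode_rdv n m T t b"
    have nodes: "nodes T = {..<m}"
      using G(2) unfolding m_def .
    have tree: "is_rooted_tree T"
      and tb: "\<And>z. z < n \<Longrightarrow> t z < m \<and> b z < m \<and> below p (b z) (t z)"
      using rep G(1) nodes unfolding rdv_representation_def descendant_def below_def p_def by auto
    have r: "root T < m" "p (root T) = root T" and p: "\<And>x. x < m \<Longrightarrow> p x < m \<and> below p x (root T)"
      using tree nodes unfolding is_rooted_tree_def below_def p_def by auto
    \<comment> \<open>A tree has a root, so \<open>n = 0\<close> would contradict
      \<open>m \<le> C * n\<close>.\<close>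
    have m: "0 < m" "m \<le> C * n" and n: "0 < n"
      using r G(3) unfolding m_def by (auto intro: gr0I)
    have "real (n + m + 2) \<le> (real C + 1) * (real n + 2)"
    proof -
      have "real m \<le> real C * real n"
        using m(2) by (metis of_nat_le_iff of_nat_mult)
      then show ?thesis
        by (simp add: algebra_simps)
    qed
    then have "16 * (real (n + m + 2))\<^sup>2 \<le> 16 * ((real C + 1) * (real n + 2))\<^sup>2"
      by (intro mult_left_mono power_mono) auto
    also have "\<dots> = K * (real n + 2)\<^sup>2"
      unfolding K_def by (simp add: power_mult_distrib)
    also have "\<dots> = 2 powr (log 2 K + 2 * log 2 (real n + 2))"
      unfolding mult_2 powr_add using K by (simp del: add_log_eq_powr log_add_eq_powr add: power2_eq_square)
    also have "\<dots> \<le> 2 powr real w"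
    proof (rule powr_mono)
      have "1 \<le> log 2 (real n + 2)"
        by simp
      then have "log 2 K * 1 \<le> log 2 K * log 2 (real n + 2)"
        using K by (intro mult_left_mono) auto
      then show "log 2 K + 2 * log 2 (real n + 2) \<le> real w"
        using word unfolding \<kappa>_def by (simp add: algebra_simps)
    qed simp
    also have "\<dots> = real (2 ^ w)"
      by (simp add: powr_realpow)
    finally have wide: "16 * (n + m + 2)\<^sup>2 \<le> 2 ^ w"
      by (metis (mono_tags, lifting) of_nat_le_iff of_nat_mult of_nat_numeral of_nat_power)
    have len: "length xs = B"
      unfolding xs_def encode_rdv_def B_def by simp
    interpret domination_input w n m B p t b "\<lambda>a. xs ! a" "root T"
    proof unfold_locales
      show "xs ! (2 + x) = p x" if "x < m" for x
        using that unfolding xs_def encode_rdv_def p_def by (simp add: nth_append)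
      show "xs ! (2 + m + z) = t z" if "z < n" for z
        using that unfolding xs_def encode_rdv_def by (simp add: nth_append)
      show "xs ! (2 + m + n + z) = b z" if "z < n" for z
        using that unfolding xs_def encode_rdv_def by (simp add: nth_append)
    qed (use n m wide p r tb in \<open>simp_all add: B_def xs_def encode_rdv_def\<close>)
    have small: "a < B \<Longrightarrow> a < 2 ^ w" "m < 2 ^ w" "n < 2 ^ w" for a
      using wide_linear B by simp_all
    have "x = n \<or> x \<le> m" if "x \<in> set xs" for x
      using that p tb unfolding xs_def encode_rdv_def p_def by (auto intro: less_imp_le)
    then have "x < 2 ^ w" if "x \<in> set xs" for x
      using that small(2,3) le_less_trans by metis
    \<comment> \<open>Nothing is truncated, and the cells behind the input are 0, which is the
      initial state of all arrays.\<close>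
    then have "initial_config w xs = config_of 0 (\<lambda>_. 0, memory B (\<lambda>a. xs ! a) (\<lambda>_ _. 0))"
      using small(1) len unfolding initial_config_def by (auto simp: memory_def fun_eq_iff)
    moreover have "run_time \<le> f n"
      using run_time_le m(2) unfolding f_def by (simp add: algebra_simps)
    moreover have "(z, v) \<in> parcs G \<longleftrightarrow> vpath p (t z) (b z) \<inter> vpath p (t v) (b v) \<noteq> {}"
      if "z < n" "v < n" "z \<noteq> v" for z v
    proof -
      \<comment> \<open>Identifying the two notions of path needs some bottom-up numbering; the one
        computed by the program serves.\<close>
      obtain L pos best0 need0 where "dp_input p m (root T) n t b L pos best0 need0"
        using domination_runs by blast
      then interpret D: dp_input p m "root T" n t b L pos best0 need0 .
      show ?thesis
        using rep that G(1) tb D.downward_path_vpath [OF p_def [symmetric]]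
        unfolding rdv_representation_def by auto
    qed
    ultimately show ?thesis
      using domination_outputs [OF _ _ G(1)] unfolding xs_def m_def by blast
  qed
  show "\<exists>\<kappa> :: real. \<exists>f :: nat \<Rightarrow> nat. \<kappa> > 0 \<and>
    (\<lambda>n. real (f n)) \<in> O(\<lambda>n. real n * ln (real n)) \<and>
    (\<forall>w :: nat \<Rightarrow> nat.
       (\<lambda>n. real (w n)) \<in> \<Theta>(\<lambda>n. ln (real n)) \<and> (\<forall>n. \<kappa> * log 2 (real n + 2) \<le> real (w n)) \<longrightarrow>
       (\<forall>(n :: nat) (G :: nat pair_pre_digraph) (T :: nat rooted_tree) t b.
          pair_graph G \<and> pverts G = {..<n} \<and> nodes T = {..<card (nodes T)} \<and>
          card (nodes T) \<le> C * n \<and> rdv_representation G T t b \<longrightarrow>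
          (\<exists>ys. outputs_within (w n) domination_program (encode_rdv n (card (nodes T)) T t b) (f n) ys \<and>
                distinct ys \<and> minimum_dominating_set G (set ys))))"
    by (rule exI [of _ \<kappa>], rule exI [of _ f]) (use \<kappa> f main in auto)
qed

end
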